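(* Let $F$ be a cumulative distribution function of a probability distribution supported on $\mathcal{S}$, twice continuously differentiable on $\mathcal{S}$, let $\boldsymbol{X}_1,\boldsymbol{X}_2,\dots$ be i.i.d. with c.d.f. $F$, and let $m=m(n)\to\infty$. Then, as $n\to\infty$, $$\mathrm{MISE}[F_{n,m}^{\star}] = n^{-1}\int_{\mathcal{S}}\sigma^2(\boldsymbol{x})\,d\boldsymbol{x} - n^{-1}m^{-1/2}\int_{\mathcal{S}}V(\boldsymbol{x})\,d\boldsymbol{x} + m^{-2}\int_{\mathcal{S}}B^2(\boldsymbol{x})\,d\boldsymbol{x} + \mathrm{o}(n^{-1}m^{-1/2}) + \mathrm{o}(m^{-2}).$$ In particular, if $\int_{\mathcal{S}}B^2(\boldsymbol{x})\,d\boldsymbol{x}>0$, the asymptotically optimal choice of $m$ with respect to the MISE is $m_{\mathrm{opt}} = n^{2/3}\Big[\frac{4\int_{\mathcal{S}}B^2(\boldsymbol{x})d\boldsymbol{x}}{\int_{\mathcal{S}}V(\boldsymbol{x})d\boldsymbol{x}}\Big]^{2/3}$, in which case $$\mathrm{MISE}[F_{n,m_{\mathrm{opt}}}^{\star}] = n^{-1}\int_{\mathcal{S}}\sigma^2(\boldsymbol{x})\,d\boldsymbol{x} - n^{-4/3}\,\frac34\Bigg[\frac{\big(\int_{\mathcal{S}}V(\boldsymbol{x})d\boldsymbol{x}\big)^4}{4\int_{\mathcal{S}}B^2(\boldsymbol{x})d\boldsymbol{x}}\Bigg]^{1/3} + \mathrm{o}(n^{-4/3}),\quad n\to\infty.$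$
   Context: Let $d\ge1$, $\|\boldsymbol{x}\|_1=\sum_i|x_i|$, $\mathcal{S}:=\{\boldsymbol{x}\in[0,1]^d:\|\boldsymbol{x}\|_1\le1\}$. For $\boldsymbol{k}\in\mathbb{N}_0^d$ with $\|\boldsymbol{k}\|_1\le m$ (written $\boldsymbol{k}\in\mathbb{N}_0^d\cap m\mathcal{S}$), $P_{\boldsymbol{k},m}(\boldsymbol{x}) := \frac{m!}{(m-\|\boldsymbol{k}\|_1)!\prod_i k_i!}(1-\|\boldsymbol{x}\|_1)^{m-\|\boldsymbol{k}\|_1}\prod_i x_i^{k_i}$. $F_n(\boldsymbol{x}) := n^{-1}\sum_{i=1}^n\mathbf{1}\{\boldsymbol{X}_i\le\boldsymbol{x}\}$ (componentwise), $F_{n,m}^{\star}(\boldsymbol{x}) := \sum_{\boldsymbol{k}\in\mathbb{N}_0^d\cap m\mathcal{S}}F_n(\boldsymbol{k}/m)P_{\boldsymbol{k},m}(\boldsymbol{x})$, and $\mathrm{MISE}[F_{n,m}^{\star}] := \int_{\mathcal{S}}\mathbb{E}[(F_{n,m}^{\star}(\boldsymbol{x})-F(\boldsymbol{x}))^2]\,d\boldsymbol{x}$. Also $B(\boldsymbol{x}) := \frac12\sum_{i,j=1}^d(x_i\mathbf{1}_{\{i=j\}}-x_ix_j)\frac{\partial^2}{\partial x_i\partial x_j}F(\boldsymbol{x})$, $\sigma^2(\boldsymbol{x}) := F(\boldsymbol{x})(1-F(\boldsymbol{x}))$, $V(\boldsymbol{x}) := \sum_{i=1}^d\frac{\partial}{\partial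 x_i}F(\boldsymbol{x})\sqrt{x_i(1-x_i)/\pi}$. *)

theory Defs
  imports "HOL-Probability.Probability" "HOL-Library.Landau_Symbols"
begin

definition l1norm :: "real^'d \<Rightarrow> real" where
  "l1norm x = (\<Sum>i\<in>UNIV. \<bar>x $ i\<bar>)"

definition Ssimplex :: "(real^'d) set" where
  "Ssimplex = {x. (\<forall>i. 0 \<le> x $ i \<and> x $ i \<le> 1) \<and> l1norm x \<le> 1}"

definition knorm :: "nat^'d \<Rightarrow> nat" where
  "knorm k = (\<Sum>i\<in>UNIV. k $ i)"

definition Kset :: "nat \<Rightarrow> (nat^'d) set" where
  "Kset m = {k. knorm k \<le> m}"

definition bernP :: "nat^'d \<Rightarrow> nat \<Rightarrow> real^'d \<Rightarrow> real" where
  "bernP k m x =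
     fact m / (fact (m - knorm k) * (\<Prod>i\<in>UNIV. fact (k $ i)))
     * (1 - l1norm x) ^ (m - knorm k) * (\<Prod>i\<in>UNIV. (x $ i) ^ (k $ i))"

definition Fn :: "(nat \<Rightarrow> 'a \<Rightarrow> real^'d) \<Rightarrow> nat \<Rightarrow> real^'d \<Rightarrow> 'a \<Rightarrow> real" where
  "Fn X n x \<omega> = (\<Sum>i=1..n. if (\<forall>j. X i \<omega> $ j \<le> x $ j) then 1 else 0) / real n"

definition Fstar :: "(nat \<Rightarrow> 'a \<Rightarrow> real^'d) \<Rightarrow> nat \<Rightarrow> nat \<Rightarrow> real^'d \<Rightarrow> 'a \<Rightarrow> real" where
  "Fstar X n m x \<omega> =
     (\<Sum>k\<in>Kset m. Fn X n (\<chi> i. real (k $ i) / real m) \<omega> * bernP k m x)"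

definition MISE :: "'a measure \<Rightarrow> (nat \<Rightarrow> 'a \<Rightarrow> real^'d) \<Rightarrow> (real^'d \<Rightarrow> real) \<Rightarrow> nat \<Rightarrow> nat \<Rightarrow> real" where
  "MISE M X F n m =
     (LINT x:Ssimplex|lborel. (LINT \<omega>|M. (Fstar X n m x \<omega> - F x)^2))"

definition has_partial :: "(real^'d \<Rightarrow> real) \<Rightarrow> 'd \<Rightarrow> real \<Rightarrow> real^'d \<Rightarrow> bool" where
  "has_partial f i D x \<longleftrightarrow> ((\<lambda>t. f (x + t *\<^sub>R axis i 1)) has_real_derivative D) (at 0)"

definition C2_partials :: "(real^'d) set \<Rightarrow> (real^'d \<Rightarrow> real) \<Rightarrow> ('d \<Rightarrow> real^'d \<Rightarrow> real)
     \<Rightarrow> ('d \<Rightarrow> 'd \<Rightarrow> real^'d \<Rightarrow> real) \<Rightarrow> bool" where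
  "C2_partials U G D1 D2 \<longleftrightarrow>
     (\<forall>x\<in>U. \<forall>i. has_partial G i (D1 i x) x) \<and>
     (\<forall>x\<in>U. \<forall>i j. has_partial (D1 i) j (D2 i j x) x) \<and>
     (\<forall>i. continuous_on U (D1 i)) \<and> (\<forall>i j. continuous_on U (D2 i j))"

definition Bfun :: "('d \<Rightarrow> 'd \<Rightarrow> real^'d \<Rightarrow> real) \<Rightarrow> real^'d \<Rightarrow> real" where
  "Bfun D2 x = 1/2 * (\<Sum>i\<in>UNIV. \<Sum>j\<in>UNIV.
      ((if i = j then x $ i else 0) - x $ i * x $ j) * D2 i j x)"

definition sigma2 :: "(real^'d \<Rightarrow> real) \<Rightarrow> real^'d \<Rightarrow> real" where
  "sigma2 F x = F x * (1 - F x)"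

definition Vfun :: "('d \<Rightarrow> real^'d \<Rightarrow> real) \<Rightarrow> real^'d \<Rightarrow> real" where
  "Vfun D1 x = (\<Sum>i\<in>UNIV. D1 i x * sqrt (x $ i * (1 - x $ i) / pi))"

end

theory Submission
  imports Defs "HOL-Real_Asymp.Real_Asymp"
begin

text \<open>
  The mean squared error at \<open>x\<close> is \<open>(E F(min (K, L) / m) - (E F(K / m))\<^sup>2) / n + (E F(K / m) - F x)\<^sup>2\<close>,
  where \<open>K\<close> and \<open>L\<close> are independent multinomial vectors with parameters \<open>m\<close> and \<open>x\<close>. A second-order Taylor
  expansion shows that the bias is asymptotic to \<open>B x / m\<close>. In the variance, a first-order expansion
  leaves the term \<open>\<partial>\<^sub>i F x * E (min (K\<^sub>i, L\<^sub>i) - m * x\<^sub>i) / m = - \<partial>\<^sub>i F x * E \<bar>K\<^sub>i - L\<^sub>i\<bar> / (2 * m)\<close>, and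
  \<open>E \<bar>K\<^sub>i - L\<^sub>i\<bar> / sqrt m\<close> converges to the mean of \<open>\<bar>N\<bar>\<close>, with \<open>N\<close> centred normal of variance
  \<open>2 * x\<^sub>i * (1 - x\<^sub>i)\<close>. This limit is obtained from \<open>c * \<bar>z\<bar> = \<integral> (1 - cos (z * t)) / t\<^sup>2 dt\<close>, which
  expresses both means through characteristic functions, so that the constant \<open>c\<close> is never evaluated.
  Dominated convergence then integrates the pointwise expansions over the simplex.
\<close>

section \<open>Multinomial averages\<close>

text \<open>The product of the indicators of two lower orthants is the indicator of the orthant
  below the componentwise minimum, which is how \<open>min\<close> enters the second moment. The
  multinomial vectors are never constructed: \<open>bern_mean\<close> is a finite weighted sum, and
  its moments and characteristic functions follow from a one-trial recursion in \<open>m\<close>.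
  Convergence in distribution would not by itself give convergence of the mean absolute difference;
  in the integral representation one majorant in \<open>t\<close> takes over the role of uniform
  integrability. The two Taylor orders reflect two scales: in the variance an error O(1/m) is
  already below \<open>1 / sqrt m\<close>, whereas the bias has no linear term and needs the
  Hessian. Derivatives on the boundary of the simplex are those of a C2 extension \<open>G\<close>
  of \<open>F\<close>; grid points and their minima stay in the simplex, so the error formula only
  involves values where \<open>G\<close> and \<open>F\<close> agree. The optimal degree divides by
  the integral of V; that this integral is positive is derived from the monotonicity of
  \<open>F\<close> and the positivity of the integral of B^2.\<close>

definition bern_mean :: "nat \<Rightarrow> real^'d \<Rightarrow> (nat^'d \<Rightarrow> 'b::real_vector) \<Rightarrow> 'b" where
  "bern_mean m x f = (\<Sum>k\<in>Kset m. bernP k m x *\<^sub>R f k)"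

lemma finite_Kset [simp]: "finite (Kset m :: (nat^'d) set)"
proof -
  have "k $ i \<le> m" if "k \<in> Kset m" for k :: "nat^'d" and i
    using that member_le_sum[of i UNIV "\<lambda>i. k $ i"] by (auto simp: Kset_def knorm_def)
  then have "(Kset m :: (nat^'d) set) \<subseteq> vec_lambda ` (PiE UNIV (\<lambda>_. {..m}))"
    by (intro subsetI, rule_tac x="vec_nth x" in image_eqI) (auto simp: PiE_def)
  then show ?thesis
    by (rule finite_subset) (intro finite_imageI finite_PiE; simp)
qed

lemma knorm_add_axis [simp]: "knorm (k + axis i (Suc 0)) = Suc (knorm k)" "knorm (k + axis i 1) = Suc (knorm k)"
  by (simp_all add: knorm_def axis_def sum.distrib)

lemma prod_add_axis:
  fixes g :: "'d::finite \<Rightarrow> nat \<Rightarrow> real"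
  shows "(\<Prod>j\<in>UNIV. g j ((k + axis i 1) $ j)) = g i (Suc (k $ i)) * (\<Prod>j\<in>UNIV - {i}. g j (k $ j))"
  by (subst prod.remove[of _ i]) (auto simp: axis_def intro!: prod.cong)

text \<open>Absorption identity for multinomial coefficients, stated without division and with the
  index shifted upwards, so that no truncated subtraction of naturals appears in the index.\<close>

lemma bernP_add_axis:
  "real (Suc (k $ i)) * bernP (k + axis i 1) (Suc m) x = real (Suc m) * x $ i * bernP k m x"
proof -
  have 1: "(\<Prod>j\<in>UNIV. fact ((k + axis i 1) $ j)) = real (Suc (k $ i)) * (\<Prod>j\<in>UNIV. fact (k $ j))"
    using prod_add_axis[of "\<lambda>_. fact" k i] prod.remove[of UNIV i "\<lambda>j. fact (k $ j) :: real"] by simp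
  have 2: "(\<Prod>j\<in>UNIV. x $ j ^ ((k + axis i 1) $ j)) = x $ i * (\<Prod>j\<in>UNIV. x $ j ^ (k $ j))"
    using prod_add_axis[of "\<lambda>j n. x $ j ^ n" k i] prod.remove[of UNIV i "\<lambda>j. x $ j ^ (k $ j)"] by simp
  show ?thesis
    unfolding bernP_def 1 2 knorm_add_axis diff_Suc_Suc fact_Suc of_nat_mult
    by (simp add: divide_simps)
qed

text \<open>Absorption for the residual category, whose count among \<open>Suc m\<close> trials is
  \<open>Suc m - knorm k\<close>. Membership in \<open>Kset m\<close> makes this count a genuine
  successor.\<close>

lemma bernP_Suc:
  assumes "k \<in> Kset m"
  shows "(real (Suc m) - real (knorm k)) * bernP k (Suc m) x = real (Suc m) * (1 - l1norm x) * bernP k m x"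
proof -
  have *: "Suc m - knorm k = Suc (m - knorm k)" "real (Suc m) - real (knorm k) = real (Suc (m - knorm k))"
    using assms by (auto simp: Kset_def)
  show ?thesis
    unfolding bernP_def * fact_Suc of_nat_mult
    by (simp add: divide_simps del: of_nat_Suc)
qed

lemma Kset_shift: "{k \<in> Kset (Suc m). k $ i \<noteq> 0} = (\<lambda>k. k + axis i 1) ` Kset m"
proof (intro set_eqI iffI)
  fix k assume k: "k \<in> {k \<in> Kset (Suc m). k $ i \<noteq> 0}"
  define l where "l = (\<chi> j. k $ j - axis i 1 $ j)"
  have kl: "k = l + axis i 1"
    using k by (auto simp: l_def vec_eq_iff axis_def)
  with k have "l \<in> Kset m" by (auto simp: Kset_def)
  with kl show "k \<in> (\<lambda>k. k + axis i 1) ` Kset m" by blast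
qed (auto simp: Kset_def)

text \<open>Conditioning on one trial: it falls into category \<open>i\<close> with weight
  \<open>x $ i\<close> and into the residual category with weight \<open>1 - l1norm x\<close>. Every
  moment below is obtained from this recursion by induction on \<open>m\<close>.\<close>

lemma bern_mean_Suc:
  "bern_mean (Suc m) x f = (1 - l1norm x) *\<^sub>R bern_mean m x f
     + (\<Sum>i\<in>UNIV. (x $ i) *\<^sub>R bern_mean m x (\<lambda>k. f (k + axis i 1)))"
proof -
  let ?P = "\<lambda>k. bernP k (Suc m) x"
  have shift: "(\<Sum>k\<in>Kset (Suc m). (real (k $ i) * ?P k) *\<^sub>R f k)
      = (\<Sum>k\<in>Kset m. (real (Suc m) * x $ i * bernP k m x) *\<^sub>R f (k + axis i 1))" for i
  proof -
    have "(\<Sum>k\<in>Kset (Suc m). (real (k $ i) * ?P k) *\<^sub>R f k)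
        = (\<Sum>k\<in>{k \<in> Kset (Suc m). k $ i \<noteq> 0}. (real (k $ i) * ?P k) *\<^sub>R f k)"
      by (intro sum.mono_neutral_right) auto
    also have "\<dots> = (\<Sum>k\<in>Kset m. (real (Suc (k $ i)) * ?P (k + axis i 1)) *\<^sub>R f (k + axis i 1))"
      unfolding Kset_shift by (subst sum.reindex) (auto simp: inj_on_def axis_def)
    finally show ?thesis unfolding bernP_add_axis .
  qed
  have stay: "(\<Sum>k\<in>Kset (Suc m). ((real (Suc m) - real (knorm k)) * ?P k) *\<^sub>R f k)
      = (\<Sum>k\<in>Kset m. (real (Suc m) * (1 - l1norm x) * bernP k m x) *\<^sub>R f k)"
  proof -
    \<comment> \<open>The additional indices have \<open>knorm k = Suc m\<close>, where the factor
      is zero.\<close>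
    have "(\<Sum>k\<in>Kset (Suc m). ((real (Suc m) - real (knorm k)) * ?P k) *\<^sub>R f k)
        = (\<Sum>k\<in>Kset m. ((real (Suc m) - real (knorm k)) * ?P k) *\<^sub>R f k)"
      by (intro sum.mono_neutral_right) (auto simp: not_le le_Suc_eq, auto simp: Kset_def)
    then show ?thesis by (simp add: bernP_Suc del: of_nat_Suc)
  qed
  \<comment> \<open>The factor \<open>Suc m\<close> is split into the residual count plus the
    coordinates of \<open>k\<close>; each of these counts is then absorbed by \<open>stay\<close> or
    \<open>shift\<close>.\<close>
  have "real (Suc m) *\<^sub>R bern_mean (Suc m) x f
      = (\<Sum>k\<in>Kset (Suc m). ((real (Suc m) - real (knorm k)) * ?P k + (\<Sum>i\<in>UNIV. real (k $ i) * ?P k)) *\<^sub>R f k)"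
    unfolding bern_mean_def scaleR_sum_right
    by (intro sum.cong) (auto simp: knorm_def algebra_simps simp flip: sum_distrib_right sum_distrib_left)
  also have "\<dots> = (\<Sum>k\<in>Kset (Suc m). ((real (Suc m) - real (knorm k)) * ?P k) *\<^sub>R f k)
      + (\<Sum>i\<in>UNIV. \<Sum>k\<in>Kset (Suc m). (real (k $ i) * ?P k) *\<^sub>R f k)"
    by (subst sum.swap) (simp add: scaleR_left_distrib sum.distrib scaleR_sum_left)
  also have "\<dots> = real (Suc m) *\<^sub>R ((1 - l1norm x) *\<^sub>R bern_mean m x f
     + (\<Sum>i\<in>UNIV. (x $ i) *\<^sub>R bern_mean m x (\<lambda>k. f (k + axis i 1))))"
    unfolding shift stay bern_mean_def
    by (simp add: scaleR_sum_right scaleR_right_distrib ac_simps del: of_nat_Suc)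
  finally show ?thesis
    by (simp del: of_nat_Suc)
qed

lemma bern_mean_0 [simp]:
  fixes x :: "real^'d"
  shows "bern_mean 0 x f = f 0"
proof -
  have "Kset 0 = {0 :: nat^'d}" by (auto simp: Kset_def knorm_def vec_eq_iff)
  then show ?thesis by (simp add: bern_mean_def bernP_def knorm_def)
qed

lemma bern_mean_add: "bern_mean m x (\<lambda>k. f k + g k) = bern_mean m x f + bern_mean m x g"
  by (simp add: bern_mean_def scaleR_right_distrib sum.distrib)

lemma bern_mean_diff: "bern_mean m x (\<lambda>k. f k - g k) = bern_mean m x f - bern_mean m x g"
  by (simp add: bern_mean_def scaleR_right_diff_distrib sum_subtractf)

lemma bern_mean_cmult:
  "bern_mean m x (\<lambda>k. c * f k) = c * (bern_mean m x f :: 'b::real_algebra)"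
  by (simp add: bern_mean_def sum_distrib_left)

lemma bern_mean_multc:
  "bern_mean m x (\<lambda>k. f k * c) = (bern_mean m x f :: 'b::real_algebra) * c"
  by (simp add: bern_mean_def sum_distrib_right)

lemma bern_mean_divide:
  "bern_mean m x (\<lambda>k. f k / c) = (bern_mean m x f :: real) / c"
  by (simp add: bern_mean_def sum_divide_distrib)

lemma bern_mean_sum: "bern_mean m x (\<lambda>k. \<Sum>i\<in>A. f i k) = (\<Sum>i\<in>A. bern_mean m x (f i))"
  unfolding bern_mean_def by (subst sum.swap) (simp add: scaleR_sum_right)

lemma Ssimplex_nonneg: "x \<in> Ssimplex \<Longrightarrow> 0 \<le> x $ i"
  and Ssimplex_le_1: "x \<in> Ssimplex \<Longrightarrow> x $ i \<le> 1"
  by (auto simp: Ssimplex_def)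

lemma l1norm_eq_sum: "x \<in> Ssimplex \<Longrightarrow> l1norm x = (\<Sum>i\<in>UNIV. x $ i)"
  by (simp add: l1norm_def Ssimplex_nonneg)

lemma bernP_nonneg: "x \<in> Ssimplex \<Longrightarrow> 0 \<le> bernP k m x"
  by (auto simp: bernP_def Ssimplex_def intro!: mult_nonneg_nonneg divide_nonneg_nonneg prod_nonneg zero_le_power)

lemma bern_mean_mono:
  fixes f g :: "nat^'d \<Rightarrow> real"
  assumes "x \<in> Ssimplex" "\<And>k. k \<in> Kset m \<Longrightarrow> f k \<le> g k"
  shows "bern_mean m x f \<le> bern_mean m x g"
  using assms by (auto simp: bern_mean_def intro!: sum_mono mult_left_mono bernP_nonneg)

lemma bern_mean_nonneg:
  fixes f :: "nat^'d \<Rightarrow> real"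
  assumes "x \<in> Ssimplex" "\<And>k. k \<in> Kset m \<Longrightarrow> 0 \<le> f k"
  shows "0 \<le> bern_mean m x f"
  using assms by (auto simp: bern_mean_def intro!: sum_nonneg mult_nonneg_nonneg bernP_nonneg)

lemma bern_mean_abs_le:
  fixes f :: "nat^'d \<Rightarrow> real"
  assumes "x \<in> Ssimplex"
  shows "\<bar>bern_mean m x f\<bar> \<le> bern_mean m x (\<lambda>k. \<bar>f k\<bar>)"
  unfolding bern_mean_def
  by (rule order_trans[OF sum_abs]) (simp add: abs_mult bernP_nonneg assms)

lemma bern_mean_const [simp]: "x \<in> Ssimplex \<Longrightarrow> bern_mean m x (\<lambda>_. c) = c"
proof (induction m)
  case (Suc m)
  then show ?case
    unfolding bern_mean_Suc by (simp add: l1norm_eq_sum flip: scaleR_left.sum scaleR_left_distrib)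
qed simp

text \<open>A single coordinate is binomial: trials that land outside category \<open>i\<close>
  leave \<open>k $ i\<close> unchanged, and their weights add up to
  \<open>1 - x $ i\<close>.\<close>

lemma bern_mean_Suc_coord:
  assumes x: "x \<in> Ssimplex"
  shows "bern_mean (Suc m) x (\<lambda>k. f (k $ i)) = (1 - x $ i) *\<^sub>R bern_mean m x (\<lambda>k. f (k $ i))
     + (x $ i) *\<^sub>R bern_mean m x (\<lambda>k. f (Suc (k $ i)))"
proof -
  have l: "l1norm x = x $ i + (\<Sum>j\<in>UNIV - {i}. x $ j)"
    using x by (simp add: l1norm_eq_sum sum.remove[of UNIV i])
  show ?thesis unfolding bern_mean_Suc
    by (subst sum.remove[of _ i])
      (simp_all add: axis_def l algebra_simps flip: scaleR_left.sum)
qed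

section \<open>Moments up to order four and characteristic functions\<close>

lemma bern_mean_coord: "x \<in> Ssimplex \<Longrightarrow> bern_mean m x (\<lambda>k. real (k $ i)) = real m * x $ i"
proof (induction m)
  case (Suc m)
  then show ?case
    using bern_mean_Suc_coord[OF Suc(2), of m real i]
    by (simp add: algebra_simps bern_mean_add)
qed simp

lemma bern_mean_prod:
  fixes x :: "real^'d"
  assumes x: "x \<in> Ssimplex"
  shows "bern_mean m x (\<lambda>k. real (k $ i) * real (k $ j))
    = real m * (real m - 1) * x $ i * x $ j + (if i = j then real m * x $ i else 0)"
proof (induction m)
  case (Suc m)
  let ?a = "\<lambda>l i. if i = l then 1 else 0 :: real"
  have *: "real ((k + axis l 1) $ i) * real ((k + axis l 1) $ j)
      = real (k $ i) * real (k $ j) + ?a l j * real (k $ i) + ?a l i * real (k $ j) + ?a l i * ?a l j" 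
    for k :: "nat^'d" and l
    by (auto simp: axis_def algebra_simps)
  have delta: "(\<Sum>l\<in>UNIV. x $ l * (?a l j * c)) = x $ j * c" for j c
  proof -
    have "x $ l * (?a l j * c) = (if j = l then x $ l * c else 0)" for l by simp
    then show ?thesis by simp
  qed
  have "bern_mean (Suc m) x (\<lambda>k. real (k $ i) * real (k $ j)) =
     (1 - l1norm x) * bern_mean m x (\<lambda>k. real (k $ i) * real (k $ j)) +
     (\<Sum>l\<in>UNIV. x $ l * (bern_mean m x (\<lambda>k. real (k $ i) * real (k $ j)) + ?a l j * (m * x $ i)
        + ?a l i * (m * x $ j) + ?a l i * ?a l j))"
    unfolding bern_mean_Suc * bern_mean_add bern_mean_cmult
    by (simp add: bern_mean_cmult bern_mean_coord x)
  also have "\<dots> = bern_mean m x (\<lambda>k. real (k $ i) * real (k $ j))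
      + x $ j * (m * x $ i) + x $ i * (m * x $ j) + (\<Sum>l\<in>UNIV. x $ l * (?a l i * ?a l j))"
    unfolding distrib_left sum.distrib delta
    by (simp add: l1norm_eq_sum x algebra_simps flip: sum_distrib_right)
  also have "(\<Sum>l\<in>UNIV. x $ l * (?a l i * ?a l j)) = (if i = j then x $ i else 0)"
  proof -
    have "x $ l * (?a l i * ?a l j) = (if i = l then (if i = j then x $ l else 0) else 0)" for l by auto
    then show ?thesis by simp
  qed
  finally show ?case unfolding Suc by (simp add: algebra_simps)
qed simp

text \<open>The matrix with entries \<open>(if i = j then x $ i else 0) - x $ i * x $ j\<close> is
  the one that weights the second derivatives in \<open>Bfun\<close>; the leading term of the bias
  originates here.\<close>

lemma bern_cov:
  fixes x :: "real^'d"
  assumes x: "x \<in> Ssimplex"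
  shows "bern_mean m x (\<lambda>k. (real (k $ i) - m * x $ i) * (real (k $ j) - m * x $ j))
    = real m * ((if i = j then x $ i else 0) - x $ i * x $ j)"
proof -
  have "(real (k $ i) - m * x $ i) * (real (k $ j) - m * x $ j) =
     real (k $ i) * real (k $ j) - (m * x $ j) * real (k $ i) - (m * x $ i) * real (k $ j) + m * x $ i * (m * x $ j)"
    for k :: "nat^'d" by (simp add: algebra_simps)
  then have "bern_mean m x (\<lambda>k. (real (k $ i) - m * x $ i) * (real (k $ j) - m * x $ j)) = 
      bern_mean m x (\<lambda>k. real (k $ i) * real (k $ j)) - (m * x $ j) * (m * x $ i) - (m * x $ i) * (m * x $ j) + m * x $ i * (m * x $ j)"
    using x by (simp only: bern_mean_add bern_mean_diff bern_mean_cmult bern_mean_coord bern_mean_const)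
  then show ?thesis unfolding bern_mean_prod[OF x] by (simp add: algebra_simps)
qed

text \<open>Only the order \<open>m^2\<close> matters, since it makes the quartic Taylor remainder
  negligible against \<open>1 / m\<close>. The induction closes because one trial adds at most
  \<open>6 * m + 1\<close>, while \<open>4 * m^2\<close> grows by \<open>8 * m + 4\<close>.\<close>

lemma bern_mean_fourth_moment:
  fixes x :: "real^'d"
  assumes x: "x \<in> Ssimplex"
  shows "bern_mean m x (\<lambda>k. (real (k $ i) - m * x $ i) ^ 4) \<le> 4 * (real m)\<^sup>2"
proof (induction m)
  case (Suc m)
  define p where "p = x $ i"
  have p: "0 \<le> p" "p \<le> 1" using x by (auto simp: p_def Ssimplex_nonneg Ssimplex_le_1)
  define Y where "Y k = real (k $ i) - m * p" for k :: "nat^'d"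
  define v where "v = p * (1 - p)"
  have v: "0 \<le> v" "v \<le> 1" using p by (auto simp: v_def mult_le_one)
  have Y1: "bern_mean m x Y = 0"
    unfolding Y_def bern_mean_diff by (simp add: bern_mean_coord x p_def)
  have Y2: "bern_mean m x (\<lambda>k. (Y k)\<^sup>2) = m * v"
    using bern_cov[OF x, of m i i] by (simp add: Y_def v_def p_def power2_eq_square algebra_simps)
  have "bern_mean (Suc m) x (\<lambda>k. (real (k $ i) - Suc m * p) ^ 4)
      = (1 - p) * bern_mean m x (\<lambda>k. (Y k - p) ^ 4) + p * bern_mean m x (\<lambda>k. (Y k + (1 - p)) ^ 4)"
    by (subst bern_mean_Suc_coord[OF x, of m "\<lambda>k. (real k - Suc m * p) ^ 4" i])
      (simp add: Y_def p_def[symmetric] algebra_simps)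
  \<comment> \<open>The coefficients come from the moments of a centred Bernoulli variable: mean 0,
    variance \<open>v\<close>, third moment \<open>v * (1 - 2 * p)\<close>, fourth moment
    \<open>v * (1 - 3 * v)\<close>.\<close>
  also have "\<dots> = bern_mean m x (\<lambda>k. Y k ^ 4 + (6 * v) * (Y k)\<^sup>2 + (4 * v * (1 - 2 * p)) * Y k + v * (1 - 3 * v))"
    unfolding bern_mean_cmult[symmetric] bern_mean_add[symmetric]
    by (rule arg_cong[where f="bern_mean m x"]) (auto simp: v_def power4_eq_xxxx power2_eq_square algebra_simps)
  also have "\<dots> = bern_mean m x (\<lambda>k. Y k ^ 4) + 6 * v * (m * v) + v * (1 - 3 * v)"
    unfolding bern_mean_add bern_mean_cmult Y1 Y2 by (simp add: x)
  also have "\<dots> \<le> 4 * (real m)\<^sup>2 + 6 * m + 1"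
  proof -
    have "v * v \<le> 1" using v by (simp add: mult_le_one)
    then have "6 * v * (m * v) \<le> 6 * m" using mult_left_mono[of "v * v" 1 "6 * real m"] by (simp add: ac_simps)
    moreover have "v * (1 - 3 * v) \<le> 1" using v by (sos)
    moreover have "bern_mean m x (\<lambda>k. Y k ^ 4) \<le> 4 * (real m)\<^sup>2" using Suc by (simp add: Y_def p_def)
    ultimately show ?thesis by linarith
  qed
  also have "\<dots> \<le> 4 * (real (Suc m))\<^sup>2" by (simp add: power2_eq_square algebra_simps)
  finally show ?case by (simp add: p_def)
qed simp

text \<open>The binomial characteristic function. It is complex-valued, which is why
  \<open>bern_mean\<close> is defined for integrands in any real vector space.\<close>

lemma bern_mean_cis:
  assumes x: "x \<in> Ssimplex"
  shows "bern_mean m x (\<lambda>k. cis (t * real (k $ i))) = (complex_of_real (1 - x $ i) + x $ i * cis t) ^ m"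
proof (induction m)
  case (Suc m)
  have "bern_mean (Suc m) x (\<lambda>k. cis (t * real (k $ i))) = (1 - x $ i) *\<^sub>R bern_mean m x (\<lambda>k. cis (t * real (k $ i)))
     + (x $ i) *\<^sub>R bern_mean m x (\<lambda>k. cis (t * real (k $ i)) * cis t)"
    using bern_mean_Suc_coord[OF x, of m "\<lambda>k. cis (t * real k)" i]
    by (simp add: algebra_simps cis_mult)
  then show ?case
    unfolding bern_mean_multc Suc by (simp add: scaleR_conv_of_real algebra_simps)
qed simp

text \<open>The difference of two independent copies has as characteristic function the squared
  modulus of the common one, and \<open>\<bar>1 - p + p * cis t\<bar>^2 = 1 - 2 * p * (1 - p) * (1 -
  cos t)\<close>.\<close>

lemma bern_mean_cos_diff:
  assumes x: "x \<in> Ssimplex"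
  shows "bern_mean m x (\<lambda>k. bern_mean m x (\<lambda>l. cos (t * (real (k $ i) - real (l $ i)))))
     = (1 - 2 * (x $ i * (1 - x $ i)) * (1 - cos t)) ^ m"
proof -
  let ?z = "complex_of_real (1 - x $ i) + x $ i * cis t"
  define C S where "C = bern_mean m x (\<lambda>k. cos (t * real (k $ i)))" and "S = bern_mean m x (\<lambda>k. sin (t * real (k $ i)))"
  have "bern_mean m x (\<lambda>k. bern_mean m x (\<lambda>l. cos (t * (real (k $ i) - real (l $ i))))) = C\<^sup>2 + S\<^sup>2"
    by (simp add: right_diff_distrib cos_diff bern_mean_add bern_mean_cmult bern_mean_multc power2_eq_square C_def S_def)
  moreover have "C = Re (?z ^ m)" "S = Im (?z ^ m)"
    using arg_cong[OF bern_mean_cis[OF x, of m t i], of Re] arg_cong[OF bern_mean_cis[OF x, of m t i], of Im]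
    by (simp_all add: C_def S_def bern_mean_def)
  moreover have "(Re (?z ^ m))\<^sup>2 + (Im (?z ^ m))\<^sup>2 = ((Re ?z)\<^sup>2 + (Im ?z)\<^sup>2) ^ m"
    by (metis cmod_power2 norm_power power_mult mult.commute)
  moreover have "(Re ?z)\<^sup>2 + (Im ?z)\<^sup>2 = 1 - 2 * (x $ i * (1 - x $ i)) * (1 - cos t)"
    by (simp add: sin_squared_eq power_mult_distrib) algebra
  ultimately show ?thesis by simp
qed

section \<open>Taylor expansion on the simplex\<close>

lemma has_partial_line:
  assumes "has_partial G i D (b + (s * c) *\<^sub>R axis i 1)"
  shows "((\<lambda>s. G (b + (s * c) *\<^sub>R axis i 1)) has_real_derivative (D * c)) (at s)"
proof -
  have g: "((\<lambda>s'. (s' - s) * c) has_real_derivative c) (at s)"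
    by (auto intro!: derivative_eq_intros)
  have f: "((\<lambda>t. G (b + (s * c) *\<^sub>R axis i 1 + t *\<^sub>R axis i 1)) has_real_derivative D) (at ((s - s) * c))"
    using assms by (simp add: has_partial_def)
  have "(s * c) *\<^sub>R axis i 1 + ((s' - s) * c) *\<^sub>R axis i 1 = (s' * c) *\<^sub>R (axis i 1 :: real^'a)" for s'
    by (simp add: algebra_simps)
  then show ?thesis
    using DERIV_chain2[OF f g] by (simp add: add.assoc)
qed

text \<open>The way from \<open>x\<close> to \<open>x + h\<close> moves one coordinate at a time;
  \<open>x + restrict_vec A h\<close> is the corner reached once the coordinates in \<open>A\<close>
  have moved.\<close>

definition restrict_vec :: "'d set \<Rightarrow> real^'d \<Rightarrow> real^'d" where
  "restrict_vec A h = (\<chi> i. if i \<in> A then h $ i else 0)"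

text \<open>\<open>C2_partials\<close> only provides derivatives along the axes, while Taylor
  expansion needs them along arbitrary segments. The bridge is a telescoping sum over axis-parallel
  moves, each treated by the mean value theorem and the continuity of one partial
  derivative.\<close>

lemma has_derivative_continuous_partials:
  fixes G :: "real^'d \<Rightarrow> real"
  assumes U: "open U" and G: "\<And>x i. x \<in> U \<Longrightarrow> has_partial G i (D i x) x"
    and D: "\<And>i. continuous_on U (D i)" and x: "x \<in> U"
  shows "(G has_derivative (\<lambda>h. \<Sum>i\<in>UNIV. h $ i * D i x)) (at x)"
  unfolding has_derivative_at_alt
proof (intro conjI allI impI)
  show "bounded_linear (\<lambda>h. \<Sum>i\<in>UNIV. h $ i * D i x)"
    by (intro bounded_linear_sum bounded_linear_compose[OF bounded_linear_mult_left bounded_linear_vec_nth])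
  fix e :: real assume e: "e > 0"
  define e' where "e' = e / CARD('d)"
  have e': "e' > 0" using e by (simp add: e'_def)
  have "eventually (\<lambda>z. \<forall>i. dist (D i z) (D i x) < e') (nhds x)"
  proof (rule eventually_all_finite)
    fix i
    have "isCont (D i) x" using D[of i] U x by (simp add: continuous_on_eq_continuous_at)
    then show "eventually (\<lambda>z. dist (D i z) (D i x) < e') (nhds x)"
      using e' by (auto simp: isCont_def tendsto_iff eventually_nhds_conv_at)
  qed
  moreover have "eventually (\<lambda>z. z \<in> U) (nhds x)" using U x by (rule eventually_nhds_in_open)
  ultimately have "eventually (\<lambda>z. z \<in> U \<and> (\<forall>i. dist (D i z) (D i x) < e')) (nhds x)"
    by eventually_elim simp
  then obtain d where d: "d > 0" "\<And>z. dist z x < d \<Longrightarrow> z \<in> U \<and> (\<forall>i. dist (D i z) (D i x) < e')"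
    unfolding eventually_nhds_metric by blast
  show "\<exists>d>0. \<forall>y. norm (y - x) < d \<longrightarrow> norm (G y - G x - (\<Sum>i\<in>UNIV. (y - x) $ i * D i x)) \<le> e * norm (y - x)"
  proof (intro exI conjI allI impI)
    fix y assume y: "norm (y - x) < d"
    define h where "h = y - x"
    have h: "norm h < d" using y by (simp add: h_def)
    \<comment> \<open>Each move costs at most \<open>e' * norm h\<close>, and there are
      \<open>CARD('d)\<close> moves, whence \<open>e' = e / CARD('d)\<close>. Intermediate points
      stay near \<open>x\<close> because their displacement is dominated componentwise by
      \<open>h\<close>.\<close>
    have claim: "\<bar>G (x + restrict_vec A h) - G x - (\<Sum>i\<in>A. h $ i * D i x)\<bar> \<le> card A * (e' * norm h)" for A
    proof (induction A rule: finite_induct[OF finite])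
      case 1
      have "restrict_vec {} h = 0" by (simp add: restrict_vec_def vec_eq_iff)
      then show ?case by simp
    next
      case (2 i A)
      define b where "b = x + restrict_vec A h"
      have near: "dist (b + (s * h $ i) *\<^sub>R axis i 1) x < d" if "0 \<le> s" "s \<le> 1" for s
      proof -
        have "norm (restrict_vec A h + (s * h $ i) *\<^sub>R axis i 1) \<le> norm h"
        proof (rule norm_le_componentwise_cart)
          fix j
          show "norm ((restrict_vec A h + (s * h $ i) *\<^sub>R axis i 1) $ j) \<le> norm (h $ j)"
            using that 2 by (auto simp: restrict_vec_def axis_def abs_mult mult_left_le_one_le)
        qed
        with h show ?thesis by (simp add: b_def dist_norm add.assoc)
      qed
      have "\<exists>z. 0 < z \<and> z < 1 \<and> G (b + (1 * h $ i) *\<^sub>R axis i 1) - G (b + (0 * h $ i) *\<^sub>R axis i 1)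
          = (1 - 0) * (D i (b + (z * h $ i) *\<^sub>R axis i 1) * h $ i)"
        by (rule MVT2) (use near d G in \<open>auto intro!: has_partial_line\<close>)
      then obtain z where z: "0 < z" "z < 1" "G (b + (h $ i) *\<^sub>R axis i 1) - G b = D i (b + (z * h $ i) *\<^sub>R axis i 1) * h $ i"
        by auto
      have "b + (h $ i) *\<^sub>R axis i 1 = x + restrict_vec (insert i A) h"
        using 2 by (auto simp: b_def restrict_vec_def axis_def vec_eq_iff)
      then have "G (x + restrict_vec (insert i A) h) - G x - (\<Sum>i\<in>insert i A. h $ i * D i x)
        = (G (x + restrict_vec A h) - G x - (\<Sum>i\<in>A. h $ i * D i x)) + (D i (b + (z * h $ i) *\<^sub>R axis i 1) - D i x) * h $ i"
        using z(3) 2 by (simp add: b_def algebra_simps)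
      also have "\<bar>\<dots>\<bar> \<le> card A * (e' * norm h) + e' * norm h"
      proof -
        have "\<bar>D i (b + (z * h $ i) *\<^sub>R axis i 1) - D i x\<bar> * \<bar>h $ i\<bar> \<le> e' * norm h"
          using d(2)[OF near[of z]] z e' component_le_norm_cart[of h i]
          by (intro mult_mono) (auto simp: dist_real_def less_imp_le)
        then show ?thesis using 2(3) by (intro order_trans[OF abs_triangle_ineq] add_mono) (auto simp: abs_mult)
      qed
      finally show ?case using 2 by (simp add: algebra_simps)
    qed
    have "restrict_vec UNIV h = h" by (simp add: restrict_vec_def)
    then show "norm (G y - G x - (\<Sum>i\<in>UNIV. (y - x) $ i * D i x)) \<le> e * norm (y - x)"
      using claim[of UNIV] by (simp add: h_def e'_def)
  qed (use d in auto)
qed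

section \<open>Compactness and convexity of the simplex\<close>

lemma compact_Ssimplex: "compact (Ssimplex :: (real^'d) set)"
proof -
  have "closed (Ssimplex :: (real^'d) set)"
    unfolding Ssimplex_def l1norm_def
    by (intro closed_Collect_conj closed_Collect_all closed_Collect_le continuous_intros)
  moreover have "norm x \<le> 1" if "x \<in> Ssimplex" for x :: "real^'d"
    using norm_le_l1_cart[of x] that by (auto simp: Ssimplex_def l1norm_def)
  ultimately show ?thesis by (auto simp: compact_eq_bounded_closed bounded_iff)
qed

lemma convex_Ssimplex: "convex (Ssimplex :: (real^'d) set)"
proof (rule convexI)
  fix x y :: "real^'d" and u v :: real
  assume x: "x \<in> Ssimplex" and y: "y \<in> Ssimplex" and uv: "0 \<le> u" "0 \<le> v" "u + v = 1"
  have "l1norm (u *\<^sub>R x + v *\<^sub>R y) = u * l1norm x + v * l1norm y"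
    using x y uv by (simp add: l1norm_def Ssimplex_nonneg sum.distrib sum_distrib_left)
  moreover have "u * l1norm x + v * l1norm y \<le> 1"
    using x y uv by (intro convex_bound_le) (auto simp: Ssimplex_def)
  moreover have "u * x $ i + v * y $ i \<le> 1" for i
    using x y uv by (intro convex_bound_le) (auto simp: Ssimplex_def)
  ultimately show "u *\<^sub>R x + v *\<^sub>R y \<in> Ssimplex"
    using x y uv by (auto simp: Ssimplex_def)
qed

lemma segment_in_Ssimplex:
  assumes "x \<in> Ssimplex" "y \<in> Ssimplex" "0 \<le> t" "t \<le> 1"
  shows "x + t *\<^sub>R (y - x) \<in> Ssimplex"
proof -
  have "x + t *\<^sub>R (y - x) = (1 - t) *\<^sub>R x + t *\<^sub>R y" by (simp add: algebra_simps)
  then show ?thesis using convexD[OF convex_Ssimplex assms(1,2), of "1 - t" t] assms by simp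
qed

text \<open>The finite index type lets one statement give a common bound for a single function
  (\<open>unit\<close>), for the gradient, and for all second derivatives (index pairs).\<close>

lemma continuous_on_Ssimplex_bounded:
  fixes f :: "'i::finite \<Rightarrow> real^'d \<Rightarrow> real"
  assumes "\<And>i. continuous_on Ssimplex (f i)"
  obtains B where "B \<ge> 0" "\<And>i x. x \<in> Ssimplex \<Longrightarrow> \<bar>f i x\<bar> \<le> B"
proof -
  have "\<exists>b. \<forall>x\<in>Ssimplex. \<bar>f i x\<bar> \<le> b" for i
    using compact_imp_bounded[OF compact_continuous_image[OF assms[of i] compact_Ssimplex]]
    by (auto simp: bounded_iff)
  then obtain b where b: "\<And>x i. x \<in> Ssimplex \<Longrightarrow> \<bar>f i x\<bar> \<le> b i" by metis
  have "\<bar>f i x\<bar> \<le> (\<Sum>i\<in>UNIV. \<bar>b i\<bar>)" if "x \<in> Ssimplex" for i x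
    using b[OF that, of i] member_le_sum[of i UNIV "\<lambda>i. \<bar>b i\<bar>"] by simp
  then show ?thesis by (intro that[of "\<Sum>i\<in>UNIV. \<bar>b i\<bar>"]) (auto intro: sum_nonneg)
qed

text \<open>Smoothness on the closed simplex is read as smoothness of \<open>G\<close> on an open
  set \<open>U\<close> around it, so that two-sided partial derivatives exist at boundary points
  too.\<close>

locale smooth_on_simplex =
  fixes U :: "(real^'d) set" and G :: "real^'d \<Rightarrow> real"
    and D1 :: "'d \<Rightarrow> real^'d \<Rightarrow> real" and D2 :: "'d \<Rightarrow> 'd \<Rightarrow> real^'d \<Rightarrow> real"
  assumes U: "open U" "Ssimplex \<subseteq> U" and C2: "C2_partials U G D1 D2"
begin

lemma has_derivative_G: "x \<in> U \<Longrightarrow> (G has_derivative (\<lambda>h. \<Sum>i\<in>UNIV. h $ i * D1 i x)) (at x)"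
  using C2 by (intro has_derivative_continuous_partials[OF U(1)]) (auto simp: C2_partials_def)

lemma has_derivative_D1: "x \<in> U \<Longrightarrow> (D1 i has_derivative (\<lambda>h. \<Sum>j\<in>UNIV. h $ j * D2 i j x)) (at x)"
  using C2 by (intro has_derivative_continuous_partials[OF U(1)]) (auto simp: C2_partials_def)

lemma continuous_on_G: "continuous_on Ssimplex G"
  using has_derivative_G U(2)
  by (intro continuous_at_imp_continuous_on) (auto intro: has_derivative_continuous)

lemma continuous_on_D1: "continuous_on Ssimplex (D1 i)"
  and continuous_on_D2: "continuous_on Ssimplex (D2 i j)"
  using C2 U(2) unfolding C2_partials_def by (blast intro: continuous_on_subset)+

lemma has_real_derivative_segment:
  assumes f: "\<And>x. x \<in> U \<Longrightarrow> (f has_derivative (\<lambda>h. \<Sum>i\<in>UNIV. h $ i * D i x)) (at x)"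
    and xy: "x \<in> Ssimplex" "y \<in> Ssimplex" "0 \<le> t" "t \<le> 1"
  shows "((\<lambda>t. f (x + t *\<^sub>R (y - x))) has_real_derivative (\<Sum>i\<in>UNIV. (y - x) $ i * D i (x + t *\<^sub>R (y - x)))) (at t)"
proof -
  have "x + t *\<^sub>R (y - x) \<in> U" using segment_in_Ssimplex[OF xy] U(2) by auto
  note f[OF this]
  moreover have "((\<lambda>t. x + t *\<^sub>R (y - x)) has_derivative (\<lambda>s. s *\<^sub>R (y - x))) (at t)"
    by (auto intro!: derivative_eq_intros)
  ultimately have "((\<lambda>t. f (x + t *\<^sub>R (y - x))) has_derivative
      (\<lambda>s. \<Sum>i\<in>UNIV. (s *\<^sub>R (y - x)) $ i * D i (x + t *\<^sub>R (y - x)))) (at t)"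
    by (rule has_derivative_compose[rotated])
  then show ?thesis
    by (rule has_derivative_imp_has_field_derivative) (simp add: sum_distrib_left mult_ac)
qed

definition grad :: "real^'d \<Rightarrow> real^'d \<Rightarrow> real" where
  "grad x h = (\<Sum>i\<in>UNIV. h $ i * D1 i x)"

definition hess :: "real^'d \<Rightarrow> real^'d \<Rightarrow> real" where
  "hess x h = (\<Sum>i\<in>UNIV. \<Sum>j\<in>UNIV. h $ i * h $ j * D2 i j x)"

text \<open>Lagrange remainder for the restriction of \<open>G\<close> to the segment from
  \<open>x\<close> to \<open>y\<close>, which convexity keeps inside the simplex. The point
  \<open>t\<close> depends on \<open>y\<close>, so the Hessian must later be compared with the one
  at \<open>x\<close>.\<close>

lemma taylor_segment:
  assumes xy: "x \<in> Ssimplex" "y \<in> Ssimplex"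
  obtains t where "0 \<le> t" "t \<le> 1"
    "G y = G x + grad x (y - x) + hess (x + t *\<^sub>R (y - x)) (y - x) / 2"
proof -
  define diff where "diff = (\<lambda>m::nat. if m = 0 then (\<lambda>t. G (x + t *\<^sub>R (y - x)))
     else if m = 1 then (\<lambda>t. grad (x + t *\<^sub>R (y - x)) (y - x))
     else (\<lambda>t. hess (x + t *\<^sub>R (y - x)) (y - x)))"
  have "DERIV (diff m) t :> diff (Suc m) t" if "m < 2" "0 \<le> t" "t \<le> 1" for m t
  proof -
    have "m = 0 \<or> m = 1" using that by auto
    then show ?thesis
    proof
      assume "m = 0"
      then show ?thesis
        using has_real_derivative_segment[OF has_derivative_G xy that(2,3)] by (simp add: diff_def grad_def)
    next
      assume m: "m = 1"
      have "((\<lambda>t. \<Sum>i\<in>UNIV. (y - x) $ i * D1 i (x + t *\<^sub>R (y - x))) has_real_derivative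
        (\<Sum>i\<in>UNIV. (y - x) $ i * (\<Sum>j\<in>UNIV. (y - x) $ j * D2 i j (x + t *\<^sub>R (y - x))))) (at t)"
        by (intro DERIV_sum DERIV_cmult has_real_derivative_segment[OF has_derivative_D1 xy that(2,3)])
      then show ?thesis by (simp add: m diff_def grad_def hess_def sum_distrib_left mult.assoc)
    qed
  qed
  then have "\<exists>t. 0 < t \<and> t \<le> 1 \<and> G (x + 1 *\<^sub>R (y - x)) = (\<Sum>m<2. diff m 0 / fact m * 1 ^ m) + diff 2 t / fact 2 * 1 ^ 2"
    by (intro Maclaurin2) (auto simp: diff_def)
  then obtain t where "0 < t" "t \<le> 1" "G y = (\<Sum>m<2. diff m 0 / fact m * 1 ^ m) + diff 2 t / fact 2"
    by auto
  then show ?thesis by (intro that[of t]) (auto simp: diff_def numeral_2_eq_2)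
qed

lemma D2_bounded: obtains B where "B \<ge> 0" "\<And>x i j. x \<in> Ssimplex \<Longrightarrow> \<bar>D2 i j x\<bar> \<le> B"
proof (rule continuous_on_Ssimplex_bounded[of "\<lambda>p. D2 (fst p) (snd p)"])
  show "continuous_on Ssimplex (D2 (fst p) (snd p))" for p by (rule continuous_on_D2)
  fix B assume "B \<ge> 0" and B: "\<And>p x. x \<in> Ssimplex \<Longrightarrow> \<bar>D2 (fst p) (snd p) x\<bar> \<le> B"
  from this(1) show thesis by (rule that) (use B[of _ "(_, _)"] in simp)
qed

lemma D2_uniform: 
  assumes "e > 0" 
  obtains d where "d > 0" "\<And>x y i j. x \<in> Ssimplex \<Longrightarrow> y \<in> Ssimplex \<Longrightarrow> dist y x < d \<Longrightarrow> \<bar>D2 i j y - D2 i j x\<bar> \<le> e"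
proof -
  \<comment> \<open>Phrased with a filter so that one radius serves the finitely many index pairs at
    once.\<close>
  have "eventually (\<lambda>d. \<forall>i j. \<forall>x\<in>Ssimplex. \<forall>y\<in>Ssimplex. dist y x < d \<longrightarrow> \<bar>D2 i j y - D2 i j x\<bar> \<le> e) (at_right 0)"
  proof (intro eventually_all_finite)
    fix i j
    obtain d where d: "d > 0" "\<And>x y. x \<in> Ssimplex \<Longrightarrow> y \<in> Ssimplex \<Longrightarrow> dist y x < d \<Longrightarrow> dist (D2 i j y) (D2 i j x) < e"
      using compact_uniformly_continuous[OF continuous_on_D2 compact_Ssimplex, of i j] \<open>e > 0\<close>
      unfolding uniformly_continuous_on_def by metis
    then show "eventually (\<lambda>d. \<forall>x\<in>Ssimplex. \<forall>y\<in>Ssimplex. dist y x < d \<longrightarrow> \<bar>D2 i j y - D2 i j x\<bar> \<le> e) (at_right 0)"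
      unfolding eventually_at_right_field by (intro exI[of _ d]) (force simp: dist_real_def)
  qed
  then obtain b where b: "b > 0" "\<And>d. 0 < d \<Longrightarrow> d < b \<Longrightarrow> \<forall>i j. \<forall>x\<in>Ssimplex. \<forall>y\<in>Ssimplex. dist y x < d \<longrightarrow> \<bar>D2 i j y - D2 i j x\<bar> \<le> e"
    unfolding eventually_at_right_field by blast
  from b(2)[of "b/2"] b(1) show ?thesis by (intro that[of "b/2"]) auto
qed

lemma abs_quadratic_form_le:
  fixes h :: "real^'d"
  assumes "\<And>i j. \<bar>a i j\<bar> \<le> B"
  shows "\<bar>\<Sum>i\<in>UNIV. \<Sum>j\<in>UNIV. h $ i * h $ j * a i j\<bar> \<le> (real CARD('d))\<^sup>2 * B * (norm h)\<^sup>2"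
proof -
  have "\<bar>h $ i * h $ j * a i j\<bar> \<le> norm h * norm h * B" for i j
    unfolding abs_mult using assms[of i j]
    by (intro mult_mono) (auto simp: component_le_norm_cart)
  then have "\<bar>\<Sum>i\<in>UNIV. \<Sum>j\<in>UNIV. h $ i * h $ j * a i j\<bar> \<le> (\<Sum>i\<in>(UNIV::'d set). \<Sum>j\<in>(UNIV::'d set). norm h * norm h * B)"
    by (intro order_trans[OF sum_abs] sum_mono order_trans[OF sum_abs])
  then show ?thesis by (simp add: power2_eq_square mult_ac)
qed

text \<open>Sufficient wherever an error O(1/m) can be afforded: for the uniform bound on the bias
  and for the whole variance expansion.\<close>

lemma taylor_first_order:
  obtains C where "C \<ge> 0" "\<And>x y. x \<in> Ssimplex \<Longrightarrow> y \<in> Ssimplex \<Longrightarrow>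
    \<bar>G y - G x - grad x (y - x)\<bar> \<le> C * (norm (y - x))\<^sup>2"
proof -
  obtain B where B: "B \<ge> 0" "\<And>x i j. x \<in> Ssimplex \<Longrightarrow> \<bar>D2 i j x\<bar> \<le> B" using D2_bounded by blast
  show ?thesis
  proof (rule that[of "(real CARD('d))\<^sup>2 * B"])
    fix x y :: "real^'d" assume xy: "x \<in> Ssimplex" "y \<in> Ssimplex"
    obtain t where t: "0 \<le> t" "t \<le> 1" "G y = G x + grad x (y - x) + hess (x + t *\<^sub>R (y - x)) (y - x) / 2"
      using taylor_segment[OF xy] .
    have "\<bar>hess (x + t *\<^sub>R (y - x)) (y - x)\<bar> \<le> (real CARD('d))\<^sup>2 * B * (norm (y - x))\<^sup>2"
      unfolding hess_def by (intro abs_quadratic_form_le B segment_in_Ssimplex xy t)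
    then show "\<bar>G y - G x - grad x (y - x)\<bar> \<le> (real CARD('d))\<^sup>2 * B * (norm (y - x))\<^sup>2" using t(3) by simp
  qed (use B in simp)
qed

text \<open>Within distance \<open>d\<close>, uniform continuity of \<open>D2\<close> makes the
  remainder small relative to the square; beyond \<open>d\<close>, a square is at most a fourth
  power divided by \<open>d^2\<close>. Averaging this bound takes only second and fourth moments,
  with no separate tail estimate.\<close>

lemma taylor_second_order:
  assumes e: "e > 0"
  obtains C where "C \<ge> 0" "\<And>x y. x \<in> Ssimplex \<Longrightarrow> y \<in> Ssimplex \<Longrightarrow>
    \<bar>G y - G x - grad x (y - x) - hess x (y - x) / 2\<bar> \<le> e * (norm (y - x))\<^sup>2 + C * (norm (y - x)) ^ 4"
proof -
  obtain B where B: "B \<ge> 0" "\<And>x i j. x \<in> Ssimplex \<Longrightarrow> \<bar>D2 i j x\<bar> \<le> B" using D2_bounded by blast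
  define N where "N = (real CARD('d))\<^sup>2"
  have N: "N > 0" by (simp add: N_def)
  obtain d where d: "d > 0" "\<And>x y i j. x \<in> Ssimplex \<Longrightarrow> y \<in> Ssimplex \<Longrightarrow> dist y x < d \<Longrightarrow> \<bar>D2 i j y - D2 i j x\<bar> \<le> e / N"
    using D2_uniform[of "e / N"] e N by auto
  show ?thesis
  proof (rule that[of "N * (2 * B) / d\<^sup>2"])
    show "N * (2 * B) / d\<^sup>2 \<ge> 0" using B N by simp
    fix x y :: "real^'d" assume xy: "x \<in> Ssimplex" "y \<in> Ssimplex"
    define h where "h = y - x"
    obtain t where t: "0 \<le> t" "t \<le> 1" "G y = G x + grad x h + hess (x + t *\<^sub>R h) h / 2"
      using taylor_segment[OF xy] unfolding h_def .
    have S: "x + t *\<^sub>R h \<in> Ssimplex" unfolding h_def by (intro segment_in_Ssimplex xy t)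
    have diff: "hess (x + t *\<^sub>R h) h - hess x h = (\<Sum>i\<in>UNIV. \<Sum>j\<in>UNIV. h $ i * h $ j * (D2 i j (x + t *\<^sub>R h) - D2 i j x))"
      by (simp add: hess_def right_diff_distrib sum_subtractf)
    have "\<bar>hess (x + t *\<^sub>R h) h - hess x h\<bar> \<le> e * (norm h)\<^sup>2 + N * (2 * B) / d\<^sup>2 * (norm h) ^ 4"
    proof (cases "norm h < d")
      case True
      have "dist (x + t *\<^sub>R h) x \<le> norm h" using t by (simp add: dist_norm mult_left_le_one_le)
      with True have "\<bar>hess (x + t *\<^sub>R h) h - hess x h\<bar> \<le> N * (e / N) * (norm h)\<^sup>2"
        unfolding diff N_def by (intro abs_quadratic_form_le d(2)[unfolded N_def] xy S) auto
      moreover have "0 \<le> N * (2 * B) / d\<^sup>2 * (norm h) ^ 4" using N B by simp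
      ultimately show ?thesis using N by simp
    next
      case False
      have "\<bar>D2 i j (x + t *\<^sub>R h) - D2 i j x\<bar> \<le> 2 * B" for i j
        using B(2)[OF S, of i j] B(2)[OF xy(1), of i j] by linarith
      then have "\<bar>hess (x + t *\<^sub>R h) h - hess x h\<bar> \<le> N * (2 * B) * (norm h)\<^sup>2"
        unfolding diff N_def by (rule abs_quadratic_form_le)
      also have "\<dots> \<le> N * (2 * B) * ((norm h) ^ 4 / d\<^sup>2)"
      proof (rule mult_left_mono)
        have "(norm h)\<^sup>2 * d\<^sup>2 \<le> (norm h)\<^sup>2 * (norm h)\<^sup>2" 
          using False d by (intro mult_left_mono power_mono) auto
        then show "(norm h)\<^sup>2 \<le> (norm h) ^ 4 / d\<^sup>2" using d
          by (simp add: pos_le_divide_eq power4_eq_xxxx power2_eq_square mult_ac)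
      qed (use B N in auto)
      finally show ?thesis using e by (simp add: add_increasing)
    qed
    moreover have "0 \<le> e * (norm h)\<^sup>2 + N * (2 * B) / d\<^sup>2 * (norm h) ^ 4" using e N B by simp
    ultimately show "\<bar>G y - G x - grad x (y - x) - hess x (y - x) / 2\<bar> \<le> e * (norm (y - x))\<^sup>2 + N * (2 * B) / d\<^sup>2 * (norm (y - x)) ^ 4"
      using t(3) unfolding h_def[symmetric] by linarith
  qed
qed

end

section \<open>The mean absolute difference of two independent binomial variables\<close>

definition absolute_value_constant :: real where
  "absolute_value_constant = (\<integral>t. (1 - cos t) / t\<^sup>2 \<partial>lborel)"

lemma one_minus_cos_le: "1 - cos t \<le> t\<^sup>2 / 2" for t :: real
  using abs_sin_le_one[of "t/2"] abs_sin_x_le_abs_x[of "t/2"] cos_double_sin[of "t/2"]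
    power_mono[of "\<bar>sin (t/2)\<bar>" "\<bar>t/2\<bar>" 2] by (simp add: power2_eq_square)

text \<open>One integrable majorant for both regimes: near zero \<open>a <= t^2 / 2\<close>, in the
  tail \<open>a <= 2\<close>. Adding \<open>a <= t^2 / 2\<close> and
  \<open>a * t^2 <= 2 * t^2\<close> produces the constant 5/2. At \<open>t = 0\<close> the quotient
  is zero by convention.\<close>

lemma div_square_le:
  fixes a t :: real
  assumes "0 \<le> a" "a \<le> 2" "a \<le> t\<^sup>2 / 2"
  shows "\<bar>a / t\<^sup>2\<bar> \<le> 5/2 * inverse (1 + t\<^sup>2)"
proof (cases "t = 0")
  case False
  have "a * 2 + a * (t\<^sup>2 * 2) \<le> 5 * t\<^sup>2"
    using assms mult_right_mono[OF assms(2), of "t\<^sup>2"] by simp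
  with False show ?thesis
    using assms by (simp add: divide_simps add_nonneg_eq_0_iff add_pos_nonneg) (simp add: algebra_simps)
qed simp

lemma integrable_inverse_1_plus_square_lborel: "integrable lborel (\<lambda>x::real. inverse (1 + x\<^sup>2))"
  using integrable_inverse_1_plus_square by (simp add: set_integrable_def)

text \<open>Written as a function of \<open>z * t\<close>, the integrand carries a factor
  \<open>z^2\<close>; the change of variable takes back one factor \<open>\<bar>z\<bar>\<close>. The
  substitution degenerates at \<open>z = 0\<close>, hence the case splits.\<close>

lemma cos_integral:
  fixes z :: real
  shows "integrable lborel (\<lambda>t. (1 - cos (z * t)) / t\<^sup>2)"
    and "(\<integral>t. (1 - cos (z * t)) / t\<^sup>2 \<partial>lborel) = \<bar>z\<bar> * absolute_value_constant"
proof -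
  have b: "\<bar>(1 - cos t) / t\<^sup>2\<bar> \<le> 5/2 * inverse (1 + t\<^sup>2)" for t :: real
    using cos_ge_minus_one[of t] by (intro div_square_le one_minus_cos_le) auto
  have int1: "integrable lborel (\<lambda>t. (1 - cos t) / t\<^sup>2 :: real)"
    by (rule Bochner_Integration.integrable_bound[OF integrable_mult_right[OF integrable_inverse_1_plus_square_lborel, of "5/2"]])
      (measurable, rule AE_I2, unfold real_norm_def, rule order_trans[OF b abs_ge_self])
  have eq: "(1 - cos (z * t)) / t\<^sup>2 = z\<^sup>2 * ((1 - cos (0 + z * t)) / (0 + z * t)\<^sup>2)" for t
    by (simp add: power_mult_distrib)
  show "integrable lborel (\<lambda>t. (1 - cos (z * t)) / t\<^sup>2)"
  proof (cases "z = 0")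
    case False
    show ?thesis unfolding eq
      using lborel_integrable_real_affine[OF int1 False, of 0] by (intro integrable_mult_right) auto
  qed simp
  show "(\<integral>t. (1 - cos (z * t)) / t\<^sup>2 \<partial>lborel) = \<bar>z\<bar> * absolute_value_constant"
  proof (cases "z = 0")
    case False
    have "absolute_value_constant = \<bar>z\<bar> * (\<integral>t. (1 - cos (0 + z * t)) / (0 + z * t)\<^sup>2 \<partial>lborel)"
      unfolding absolute_value_constant_def
      by (subst lborel_integral_real_affine[OF False, of _ 0]) simp
    then have "\<bar>z\<bar> * absolute_value_constant = z\<^sup>2 * (\<integral>t. (1 - cos (0 + z * t)) / (0 + z * t)\<^sup>2 \<partial>lborel)"
      by (metis abs_mult_self_eq mult.assoc power2_eq_square)
    then show ?thesis by (subst eq) (simp del: times_divide_eq_right)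
  qed simp
qed

text \<open>Allows the constant to be cancelled in \<open>mean_gap_limit\<close>. The integrand is
  nonnegative and does not vanish on \<open>{1..2}\<close>, because cosine decreases strictly on the
  interval from 0 to pi.\<close>

lemma absolute_value_constant_pos: "absolute_value_constant > 0"
proof -
  have nn: "0 \<le> (1 - cos t) / t\<^sup>2" for t :: real by simp
  have int: "integrable lborel (\<lambda>t. (1 - cos t) / t\<^sup>2 :: real)"
    using cos_integral(1)[of 1] by simp
  have "absolute_value_constant \<noteq> 0"
  proof
    assume "absolute_value_constant = 0"
    then have ae: "AE t in lborel. (1 - cos t) / t\<^sup>2 = (0::real)"
      using integral_nonneg_eq_0_iff_AE[OF int] nn by (simp add: absolute_value_constant_def)
    have ne: "(1 - cos t) / t\<^sup>2 \<noteq> (0::real)" if "t \<in> {1..2}" for t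
      using that cos_monotone_0_pi[of 0 t] pi_gt3 by auto
    from ae have "AE t in lborel. t \<notin> {1..2::real}"
      by (rule eventually_mono) (use ne in blast)
    then have "emeasure lborel {1..2::real} = 0"
      by (subst (asm) AE_iff_measurable[where N="{1..2}"]) auto
    then show False by simp
  qed
  moreover have "absolute_value_constant \<ge> 0"
    unfolding absolute_value_constant_def by (rule Bochner_Integration.integral_nonneg) (rule nn)
  ultimately show ?thesis by simp
qed

section \<open>The Gaussian limit in integral form\<close>

lemma std_normal_cos_integral:
  "(LINT z|std_normal_distribution. cos (s * z)) = exp (- s\<^sup>2 / 2)"
proof -
  interpret real_distribution std_normal_distribution by (rule real_dist_normal_dist)
  have i: "integrable std_normal_distribution (\<lambda>z. iexp (s * z))"
    by (intro integrable_const_bound) auto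
  have "Re (char std_normal_distribution s) = (LINT z|std_normal_distribution. cos (s * z))"
    unfolding char_def integral_Re[OF i, symmetric] by (simp add: Re_exp)
  then show ?thesis by (simp add: char_std_normal_distribution)
qed

text \<open>Fubini evaluates the double integral of \<open>(1 - cos (s * z * t)) / t^2\<close> in
  two ways: over \<open>t\<close> first it is \<open>s\<close> times the mean of
  \<open>\<bar>z\<bar>\<close> times the constant, over \<open>z\<close> first the Gaussian
  characteristic function appears. The choice \<open>s = sqrt (2 * p)\<close> is the standard
  deviation of the limit law.\<close>

lemma gaussian_integral:
  fixes p :: real
  assumes p: "0 \<le> p"
  shows "(\<integral>t. (1 - exp (- p * t\<^sup>2)) / t\<^sup>2 \<partial>lborel) = 2 * sqrt (p / pi) * absolute_value_constant"
proof -
  interpret N: real_distribution std_normal_distribution by (rule real_dist_normal_dist)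
  interpret P: pair_sigma_finite std_normal_distribution "lborel :: real measure" ..
  define s where "s = sqrt (2 * p)"
  define f where "f = (\<lambda>(z::real) (t::real). (1 - cos (s * z * t)) / t\<^sup>2)"
  have nn: "0 \<le> f z t" for z t by (simp add: f_def)
  have f1: "integrable lborel (f z)" "(\<integral>t. f z t \<partial>lborel) = s * \<bar>z\<bar> * absolute_value_constant" for z
    using cos_integral[of "s * z"] p by (auto simp: f_def s_def abs_mult mult_ac)
  have absz: "integrable std_normal_distribution (\<lambda>z. \<bar>z\<bar>)" 
    using integrable_std_normal_distribution_moment[of 1] by simp
  have intf: "integrable (std_normal_distribution \<Otimes>\<^sub>M lborel) (case_prod f)"
  proof (rule P.Fubini_integrable)
    show "case_prod f \<in> borel_measurable (std_normal_distribution \<Otimes>\<^sub>M lborel)"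
      unfolding f_def by measurable
    show "integrable std_normal_distribution (\<lambda>x. LINT y|lborel. norm (case (x, y) of (x, y) \<Rightarrow> f x y))"
      using absz nn by (simp add: f1)
    show "AE x in std_normal_distribution. integrable lborel (\<lambda>y. case (x, y) of (x, y) \<Rightarrow> f x y)"
      by (simp add: f1)
  qed
  have cosi: "integrable std_normal_distribution (\<lambda>z. cos (c * z))" for c
    by (intro N.integrable_const_bound[where B=1]) auto
  have "(LINT z|std_normal_distribution. f z t) = (1 - exp (- p * t\<^sup>2)) / t\<^sup>2" for t
  proof -
    have "(LINT z|std_normal_distribution. f z t) = (LINT z|std_normal_distribution. (1 - cos ((s * t) * z)) / t\<^sup>2)"
      by (simp add: f_def mult_ac)
    also have "\<dots> = (1 - (LINT z|std_normal_distribution. cos ((s * t) * z))) / t\<^sup>2"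
      by (simp add: cosi N.prob_space[simplified])
    finally show ?thesis using p unfolding std_normal_cos_integral by (simp add: s_def power_mult_distrib)
  qed
  then have "(\<integral>t. (1 - exp (- p * t\<^sup>2)) / t\<^sup>2 \<partial>lborel) = (LINT z|std_normal_distribution. s * \<bar>z\<bar> * absolute_value_constant)"
    using P.Fubini_integral[OF intf] by (simp add: f1)
  also have "\<dots> = s * sqrt (2 / pi) * absolute_value_constant"
    using std_normal_distribution_odd_moments_abs[of 0] by simp
  also have "s * sqrt (2 / pi) = 2 * sqrt (p / pi)"
    unfolding s_def real_sqrt_mult[symmetric]
    by (rule power2_eq_imp_eq) (use p in \<open>auto simp: power_mult_distrib\<close>)
  finally show ?thesis .
qed

definition mean_gap :: "nat \<Rightarrow> real^'d \<Rightarrow> 'd \<Rightarrow> real" where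
  "mean_gap m x i = bern_mean m x (\<lambda>k. bern_mean m x (\<lambda>l. \<bar>real (k $ i) - real (l $ i)\<bar>))"

text \<open>The characteristic function of the coordinate difference is an explicit
  \<open>m\<close>-th power, so the mean gap becomes an integral whose integrand has an elementary
  limit. The scale \<open>c\<close> will be \<open>1 / sqrt m\<close>.\<close>

lemma mean_gap_integral:
  fixes x :: "real^'d"
  assumes x: "x \<in> Ssimplex" and c: "c \<ge> 0"
  shows "c * mean_gap m x i * absolute_value_constant
    = (\<integral>t. (1 - (1 - 2 * (x $ i * (1 - x $ i)) * (1 - cos (c * t))) ^ m) / t\<^sup>2 \<partial>lborel)"
proof -
  have int: "integrable lborel (\<lambda>t. bern_mean m x (\<lambda>l. (1 - cos (z l * t)) / t\<^sup>2))" for z :: "nat^'d \<Rightarrow> real"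
    unfolding bern_mean_def by (intro Bochner_Integration.integrable_sum integrable_scaleR_right cos_integral)
  let ?z = "\<lambda>k l. c * (real (k $ i) - real (l $ i))"
  have "c * mean_gap m x i * absolute_value_constant
     = bern_mean m x (\<lambda>k. bern_mean m x (\<lambda>l. \<bar>?z k l\<bar> * absolute_value_constant))"
    using c unfolding mean_gap_def by (simp add: abs_mult bern_mean_cmult bern_mean_multc)
  also have "\<dots> = bern_mean m x (\<lambda>k. \<integral>t. bern_mean m x (\<lambda>l. (1 - cos (?z k l * t)) / t\<^sup>2) \<partial>lborel)"
    unfolding cos_integral(2)[symmetric] unfolding bern_mean_def
    by (simp add: Bochner_Integration.integral_sum integrable_scaleR_right cos_integral(1) del: times_divide_eq_right)
  also have "\<dots> = (\<integral>t. bern_mean m x (\<lambda>k. bern_mean m x (\<lambda>l. (1 - cos (?z k l * t)) / t\<^sup>2)) \<partial>lborel)"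
    using int unfolding bern_mean_def[of m x "\<lambda>k. bern_mean m x (_ k)"] bern_mean_def[of m x "\<lambda>k. integral\<^sup>L lborel (_ k)"]
    by (simp add: Bochner_Integration.integral_sum integrable_scaleR_right)
  also have "\<dots> = (\<integral>t. (1 - (1 - 2 * (x $ i * (1 - x $ i)) * (1 - cos (c * t))) ^ m) / t\<^sup>2 \<partial>lborel)"
    unfolding bern_mean_divide bern_mean_diff bern_mean_cos_diff[OF x, symmetric]
    by (simp add: x mult_ac)
  finally show ?thesis .
qed

lemma bernoulli_variance_bounds: "x \<in> Ssimplex \<Longrightarrow> 0 \<le> x $ i * (1 - x $ i)" "x \<in> Ssimplex \<Longrightarrow> x $ i * (1 - x $ i) \<le> 1 / 4"
proof -
  assume x: "x \<in> Ssimplex"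
  then show "0 \<le> x $ i * (1 - x $ i)" by (simp add: Ssimplex_nonneg Ssimplex_le_1)
  show "x $ i * (1 - x $ i) \<le> 1 / 4"
    using zero_le_power2[of "x $ i - 1/2"] by (simp add: power2_eq_square algebra_simps)
qed

lemma one_minus_power_le: "0 \<le> y \<Longrightarrow> y \<le> 1 \<Longrightarrow> 1 - (1 - y) ^ m \<le> real m * y" for y :: real
  using Bernoulli_inequality[of "-y" m] by simp

theorem mean_gap_limit:
  fixes x :: "real^'d"
  assumes x: "x \<in> Ssimplex"
  shows "(\<lambda>m. mean_gap m x i / sqrt (real m)) \<longlonglongrightarrow> 2 * sqrt (x $ i * (1 - x $ i) / pi)"
proof -
  define p where "p = x $ i * (1 - x $ i)"
  have p: "0 \<le> p" "p \<le> 1/4" using bernoulli_variance_bounds[OF x] by (auto simp: p_def)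
  define q where "q = (\<lambda>m t. (1 - 2 * p * (1 - cos (1 / sqrt (real m) * t))) ^ m)"
  have q_lim: "(\<lambda>m. q m t) \<longlonglongrightarrow> exp (- p * t\<^sup>2)" for t
  proof (cases "t = 0 \<or> p = 0")
    case False
    \<comment> \<open>The asymptotic expansion needs a variable of known sign; since cosine is even,
      \<open>\<bar>t\<bar>\<close> may replace \<open>t\<close>.\<close>
    then have "p > 0" "\<bar>t\<bar> > 0" using p by auto
    then have "(\<lambda>m. (1 - 2 * p * (1 - cos (1 / sqrt (real m) * \<bar>t\<bar>))) ^ m) \<longlonglongrightarrow> exp (- (p * (\<bar>t\<bar> * \<bar>t\<bar>)))"
      by real_asymp
    moreover have "cos (1 / sqrt (real m) * \<bar>t\<bar>) = cos (1 / sqrt (real m) * t)" for m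
      using cos_abs_real[of "1 / sqrt (real m) * t"] by (simp add: abs_mult)
    ultimately show ?thesis by (simp add: q_def power2_eq_square)
  qed (auto simp: q_def)
  \<comment> \<open>As \<open>p <= 1/4\<close>, the base of the power stays in the unit interval.
    Bernoulli's inequality then bounds \<open>1 - q m t\<close> by a multiple of \<open>t^2\<close>
    that is independent of \<open>m\<close>.\<close>
  have y: "0 \<le> 2 * p * (1 - cos u)" "2 * p * (1 - cos u) \<le> 1" "2 * p * (1 - cos u) \<le> u\<^sup>2 / 4" for u
  proof -
    show "0 \<le> 2 * p * (1 - cos u)" using p by simp
    have c: "1 - cos u \<le> 2" "0 \<le> 1 - cos u" using cos_ge_minus_one[of u] cos_le_one[of u] by linarith+
    show "2 * p * (1 - cos u) \<le> 1"
      using mult_mono[of "2 * p" "1/2" "1 - cos u" 2] c p by simp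
    show "2 * p * (1 - cos u) \<le> u\<^sup>2 / 4"
      using mult_mono[of "2 * p" "1/2" "1 - cos u" "u\<^sup>2 / 2"] c p one_minus_cos_le[of u] by simp
  qed
  have bound: "\<bar>(1 - q m t) / t\<^sup>2\<bar> \<le> 5/2 * inverse (1 + t\<^sup>2)" for m t
  proof (rule div_square_le)
    have "0 \<le> q m t" "q m t \<le> 1"
      unfolding q_def using y[of "1 / sqrt (real m) * t"] by (auto intro!: power_le_one)
    then show "0 \<le> 1 - q m t" "1 - q m t \<le> 2" by auto
    have "1 - q m t \<le> real m * ((1 / sqrt (real m) * t)\<^sup>2 / 4)"
      unfolding q_def using y[of "1 / sqrt (real m) * t"]
      by (intro order_trans[OF one_minus_power_le] mult_left_mono) auto
    also have "\<dots> \<le> t\<^sup>2 / 2" by (auto simp: power_mult_distrib power_divide divide_simps)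
    finally show "1 - q m t \<le> t\<^sup>2 / 2" .
  qed
  have "(\<lambda>m. \<integral>t. (1 - q m t) / t\<^sup>2 \<partial>lborel) \<longlonglongrightarrow> (\<integral>t. (1 - exp (- p * t\<^sup>2)) / t\<^sup>2 \<partial>lborel)"
  proof (rule integral_dominated_convergence[where w="\<lambda>t. 5/2 * inverse (1 + t\<^sup>2)"])
    show "AE t in lborel. (\<lambda>m. (1 - q m t) / t\<^sup>2) \<longlonglongrightarrow> (1 - exp (- p * t\<^sup>2)) / t\<^sup>2"
    proof (intro AE_I2)
      show "(\<lambda>m. (1 - q m t) / t\<^sup>2) \<longlonglongrightarrow> (1 - exp (- p * t\<^sup>2)) / t\<^sup>2" for t
        by (cases "t = 0") (simp, intro tendsto_divide tendsto_diff tendsto_const q_lim, simp)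
    qed
    show "AE t in lborel. norm ((1 - q m t) / t\<^sup>2) \<le> 5/2 * inverse (1 + t\<^sup>2)" for m
      using bound by auto
    show "(\<lambda>t. (1 - q m t) / t\<^sup>2) \<in> borel_measurable lborel" for m unfolding q_def by measurable
  qed (auto intro!: integrable_mult_right integrable_inverse_1_plus_square_lborel)
  moreover have "(\<integral>t. (1 - q m t) / t\<^sup>2 \<partial>lborel) = 1 / sqrt (real m) * mean_gap m x i * absolute_value_constant" for m
    by (subst mean_gap_integral[OF x]) (auto simp: q_def p_def)
  ultimately have "(\<lambda>m. 1 / sqrt (real m) * mean_gap m x i * absolute_value_constant) \<longlonglongrightarrow> 2 * sqrt (p / pi) * absolute_value_constant"
    by (simp only: gaussian_integral[OF p(1)])
  from tendsto_divide[OF this tendsto_const[of absolute_value_constant]] show ?thesis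
    using absolute_value_constant_pos by (simp add: p_def)
qed

section \<open>The mean squared error at a point\<close>

text \<open>The bias-variance decomposition of a sample mean around an arbitrary centre
  \<open>c\<close>.\<close>

lemma (in prob_space) iid_mean_square_error:
  fixes Z :: "nat \<Rightarrow> 'a \<Rightarrow> real"
  assumes indep: "indep_vars (\<lambda>_. borel) Z UNIV"
    and bounded: "\<And>i \<omega>. \<bar>Z i \<omega>\<bar> \<le> B"
    and mean: "\<And>i. expectation (Z i) = b" and square: "\<And>i. expectation (\<lambda>\<omega>. (Z i \<omega>)\<^sup>2) = a"
    and n: "n > 0"
  shows "expectation (\<lambda>\<omega>. ((\<Sum>i=1..n. Z i \<omega>) / real n - c)\<^sup>2) = (a - b\<^sup>2) / n + (b - c)\<^sup>2"
proof -
  have meas [measurable]: "Z i \<in> borel_measurable M" for i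
    using indep by (auto simp: indep_vars_def)
  have int: "integrable M (Z i)" for i
    by (rule integrable_const_bound[of _ B]) (use bounded in auto)
  have int2: "integrable M (\<lambda>\<omega>. Z i \<omega> * Z j \<omega>)" for i j
  proof (rule integrable_const_bound[of _ "B * B"])
    have "\<bar>Z i \<omega> * Z j \<omega>\<bar> \<le> B * B" for \<omega>
      unfolding abs_mult using bounded abs_ge_zero[THEN order_trans, OF bounded] by (intro mult_mono) auto
    then show "AE \<omega> in M. norm (Z i \<omega> * Z j \<omega>) \<le> B * B" by auto
  qed simp
  \<comment> \<open>Independence gives \<open>b^2\<close> off the diagonal. Writing the diagonal
    value \<open>a\<close> as \<open>b^2\<close> plus a correction lets the double sum be evaluated
    in one go.\<close>
  have prod: "expectation (\<lambda>\<omega>. Z i \<omega> * Z j \<omega>) = b\<^sup>2 + (if i = j then a - b\<^sup>2 else 0)" for i j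
  proof (cases "i = j")
    case True
    then show ?thesis using square[of j] by (simp add: power2_eq_square)
  next
    case False
    have "expectation (\<lambda>\<omega>. \<Prod>k\<in>{i, j}. Z k \<omega>) = (\<Prod>k\<in>{i, j}. expectation (Z k))"
      by (intro indep_vars_lebesgue_integral indep_vars_subset[OF indep]) (auto intro: int)
    with False show ?thesis by (simp add: mean power2_eq_square)
  qed
  have sq: "((\<Sum>i=1..n. Z i \<omega>) / real n - c)\<^sup>2
      = (\<Sum>i=1..n. \<Sum>j=1..n. Z i \<omega> * Z j \<omega>) / (real n)\<^sup>2 - (2 * c / n) * (\<Sum>i=1..n. Z i \<omega>) + c\<^sup>2" for \<omega>
    unfolding sum_product[symmetric] by (simp add: power2_diff power_divide power2_eq_square[of "sum _ _"])
  have "expectation (\<lambda>\<omega>. ((\<Sum>i=1..n. Z i \<omega>) / real n - c)\<^sup>2)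
      = (\<Sum>i=1..n. \<Sum>j=1..n. expectation (\<lambda>\<omega>. Z i \<omega> * Z j \<omega>)) / (real n)\<^sup>2 - (2 * c / n) * (\<Sum>i=1..n. expectation (Z i)) + c\<^sup>2"
    unfolding sq by (simp add: int int2 Bochner_Integration.integral_sum prob_space)
  also have "\<dots> = (real n * real n * b\<^sup>2 + real n * (a - b\<^sup>2)) / (real n)\<^sup>2 - 2 * c * b + c\<^sup>2"
    unfolding prod mean sum.distrib using n by (simp add: algebra_simps)
  also have "\<dots> = (a - b\<^sup>2) / n + (b - c)\<^sup>2"
    using n by (simp add: field_simps power2_eq_square)
  finally show ?thesis .
qed

section \<open>Grid points, lower orthants and the mean squared error at a point\<close>

definition grid_point :: "nat \<Rightarrow> nat^'d \<Rightarrow> real^'d" where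
  "grid_point m k = (\<chi> i. real (k $ i) / real m)"

definition min_vec :: "real^'d \<Rightarrow> real^'d \<Rightarrow> real^'d" where
  "min_vec a b = (\<chi> i. min (a $ i) (b $ i))"

definition bern_fun :: "nat \<Rightarrow> (real^'d \<Rightarrow> real) \<Rightarrow> real^'d \<Rightarrow> real" where
  "bern_fun m F x = bern_mean m x (\<lambda>k. F (grid_point m k))"

definition bern_min :: "nat \<Rightarrow> (real^'d \<Rightarrow> real) \<Rightarrow> real^'d \<Rightarrow> real" where
  "bern_min m F x = bern_mean m x (\<lambda>k. bern_mean m x (\<lambda>l. F (min_vec (grid_point m k) (grid_point m l))))"

definition lower_orthant :: "real^'d \<Rightarrow> (real^'d) set" where
  "lower_orthant a = {y. \<forall>j. y $ j \<le> a $ j}"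

lemma lower_orthant_borel [measurable]: "lower_orthant a \<in> sets borel"
proof -
  have "closed (lower_orthant a)"
    unfolding lower_orthant_def
    by (intro closed_Collect_all closed_Collect_le continuous_intros)
  then show ?thesis by simp
qed

lemma lower_orthant_Int: "lower_orthant a \<inter> lower_orthant b = lower_orthant (min_vec a b)"
  by (auto simp: lower_orthant_def min_vec_def)

lemma grid_point_in_Ssimplex:
  fixes k :: "nat^'d"
  assumes "k \<in> Kset m"
  shows "grid_point m k \<in> Ssimplex"
proof -
  have k: "(\<Sum>i\<in>UNIV. real (k $ i)) \<le> real m"
    using assms by (simp add: Kset_def knorm_def flip: of_nat_sum)
  have "real (k $ i) \<le> real m" for i
    using order_trans[OF member_le_sum[of i UNIV "\<lambda>i. real (k $ i)"] k] by simp
  moreover have "(\<Sum>i\<in>UNIV. real (k $ i)) / real m \<le> 1"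
    using k by (cases "m = 0") (auto simp: divide_simps)
  ultimately show ?thesis
    by (auto simp: Ssimplex_def l1norm_def grid_point_def sum_divide_distrib divide_le_eq_1)
qed

lemma min_vec_in_Ssimplex:
  assumes "a \<in> Ssimplex" "b \<in> Ssimplex"
  shows "min_vec a b \<in> Ssimplex"
proof -
  have "l1norm (min_vec a b) \<le> l1norm a"
    using assms by (auto simp: l1norm_def min_vec_def Ssimplex_nonneg intro!: sum_mono)
  then show ?thesis using assms by (auto simp: Ssimplex_def min_vec_def min_le_iff_disj)
qed

text \<open>Exchanging the sum over grid points with the sum over the sample turns the estimator
  into the sample mean of the i.i.d. variables \<open>g (X i)\<close>, to which
  \<open>iid_mean_square_error\<close> applies.\<close>

lemma Fstar_mean_square_error:
  fixes X :: "nat \<Rightarrow> 'a \<Rightarrow> real^'d"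
  assumes M: "prob_space M" and mu: "prob_space \<mu>" "sets \<mu> = sets borel"
    and F_cdf: "\<And>x. F x = measure \<mu> {y. \<forall>j. y $ j \<le> x $ j}"
    and X_meas: "\<And>i. X i \<in> borel_measurable M"
    and X_dist: "\<And>i. distr M borel (X i) = \<mu>"
    and X_indep: "prob_space.indep_vars M (\<lambda>_. borel) X UNIV"
    and n: "n > 0" and x: "x \<in> Ssimplex"
  shows "(LINT \<omega>|M. (Fstar X n m x \<omega> - F x)\<^sup>2)
    = (bern_min m F x - (bern_fun m F x)\<^sup>2) / n + (bern_fun m F x - F x)\<^sup>2"
proof -
  interpret prob_space M by (rule M)
  interpret mu: prob_space \<mu> by (rule mu)
  note X_meas [measurable]
  have sets_mu [measurable_cong]: "sets \<mu> = sets borel" by (rule mu)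
  have F: "F x = measure \<mu> (lower_orthant x)" for x by (simp add: F_cdf lower_orthant_def)
  \<comment> \<open>The contribution of one observation at \<open>y\<close>. Its mean is
    \<open>bern_fun m F x\<close>, and its second moment is \<open>bern_min m F x\<close> by
    \<open>lower_orthant_Int\<close>.\<close>
  define g where "g y = bern_mean m x (\<lambda>k. indicator (lower_orthant (grid_point m k)) y :: real)" for y
  have g_meas [measurable]: "g \<in> borel_measurable borel"
    unfolding g_def bern_mean_def by measurable
  have g_nn: "0 \<le> g y" for y unfolding g_def by (intro bern_mean_nonneg x) auto
  have g_le: "g y \<le> 1" for y
    unfolding g_def using bern_mean_mono[OF x, of m "\<lambda>k. indicator (lower_orthant (grid_point m k)) y" "\<lambda>_. 1"]
    by (simp add: x indicator_def)
  have g2: "(g y)\<^sup>2 = bern_mean m x (\<lambda>k. bern_mean m x (\<lambda>l. indicator (lower_orthant (min_vec (grid_point m k) (grid_point m l))) y))" for y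
    unfolding lower_orthant_Int[symmetric] indicator_inter_arith bern_mean_cmult bern_mean_multc g_def power2_eq_square ..
  have Z_int: "expectation (\<lambda>\<omega>. h (X i \<omega>)) = (\<integral>y. h y \<partial>\<mu>)" if [measurable]: "h \<in> borel_measurable borel" for h :: "_ \<Rightarrow> real" and i
    unfolding X_dist[of i, symmetric] by (simp add: integral_distr)
  have "expectation (\<lambda>\<omega>. ((\<Sum>i=1..n. g (X i \<omega>)) / real n - F x)\<^sup>2)
    = (bern_min m F x - (bern_fun m F x)\<^sup>2) / n + (bern_fun m F x - F x)\<^sup>2"
  proof (rule iid_mean_square_error[where B=1])
    show "indep_vars (\<lambda>_. borel) (\<lambda>i \<omega>. g (X i \<omega>)) UNIV"
      by (rule indep_vars_compose2[OF X_indep]) simp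
    show "\<bar>g (X i \<omega>)\<bar> \<le> 1" for i \<omega> using g_nn g_le by simp
    show "expectation (\<lambda>\<omega>. g (X i \<omega>)) = bern_fun m F x" for i
      unfolding Z_int[OF g_meas] unfolding g_def bern_fun_def bern_mean_def F
      by (simp add: Bochner_Integration.integral_sum mu.emeasure_finite less_top[symmetric] del: sum_mult_indicator)
    show "expectation (\<lambda>\<omega>. (g (X i \<omega>))\<^sup>2) = bern_min m F x" for i
    proof -
      have "expectation (\<lambda>\<omega>. (g (X i \<omega>))\<^sup>2) = (\<integral>y. (g y)\<^sup>2 \<partial>\<mu>)" by (rule Z_int) simp
      then show ?thesis
        unfolding g2 unfolding bern_min_def bern_mean_def F
        by (simp add: Bochner_Integration.integral_sum mu.emeasure_finite less_top[symmetric] del: sum_mult_indicator)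
    qed
  qed (rule n)
  moreover have "Fstar X n m x \<omega> = (\<Sum>i=1..n. g (X i \<omega>)) / real n" for \<omega>
  proof -
    have Fn: "Fn X n (\<chi> i. real (k $ i) / real m) \<omega>
        = (\<Sum>i=1..n. indicator (lower_orthant (grid_point m k)) (X i \<omega>)) / real n" for k
      unfolding Fn_def lower_orthant_def grid_point_def
      by (intro arg_cong2[where f="(/)"] sum.cong) auto
    have "Fstar X n m x \<omega> = (\<Sum>k\<in>Kset m. (\<Sum>i=1..n. bernP k m x * indicator (lower_orthant (grid_point m k)) (X i \<omega>)) / real n)"
      unfolding Fstar_def Fn sum_distrib_left[symmetric]
      by (intro sum.cong refl) (simp only: times_divide_eq_left times_divide_eq_right mult.commute)
    also have "\<dots> = (\<Sum>i=1..n. g (X i \<omega>)) / real n"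
      unfolding g_def bern_mean_def sum_divide_distrib[symmetric] by (subst sum.swap) simp
    finally show ?thesis .
  qed
  ultimately show ?thesis by simp
qed

section \<open>Pointwise asymptotics and dominated convergence\<close>

lemma power2_norm_vec: "(norm h)\<^sup>2 = (\<Sum>i\<in>UNIV. (h $ i)\<^sup>2)" for h :: "real^'d"
  unfolding power2_norm_eq_inner inner_vec_def by (simp add: power2_eq_square)

lemma power4_norm_vec_le: "(norm h) ^ 4 \<le> real CARD('d) * (\<Sum>i\<in>UNIV. (h $ i) ^ 4)" for h :: "real^'d"
proof -
  have "(norm h) ^ 4 = (\<Sum>i\<in>UNIV. (h $ i)\<^sup>2)\<^sup>2"
    unfolding power2_norm_vec[symmetric] by simp
  also have "\<dots> \<le> (\<Sum>i\<in>UNIV. ((h $ i)\<^sup>2)\<^sup>2) * real CARD('d)"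
    by (rule sum_squared_le_sum_of_squares)
  finally show ?thesis by (simp add: mult.commute)
qed

lemma grid_point_diff: "m > 0 \<Longrightarrow> (grid_point m k - x) $ i = (real (k $ i) - m * x $ i) / m"
  by (simp add: grid_point_def field_simps)

lemma grid_point_mean:
  assumes "x \<in> Ssimplex" "m > 0"
  shows "bern_mean m x (\<lambda>k. (grid_point m k - x) $ i) = 0"
  unfolding grid_point_diff[OF assms(2)] bern_mean_divide bern_mean_diff by (simp add: assms bern_mean_coord)

lemma grid_point_cov:
  fixes x :: "real^'d"
  assumes "x \<in> Ssimplex" "m > 0"
  shows "bern_mean m x (\<lambda>k. (grid_point m k - x) $ i * (grid_point m k - x) $ j)
    = ((if i = j then x $ i else 0) - x $ i * x $ j) / m"
  using assms unfolding grid_point_diff[OF assms(2)] times_divide_times_eq bern_mean_divide bern_cov[OF assms(1)]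
  by simp

lemma grid_point_second_moment:
  fixes x :: "real^'d"
  assumes "x \<in> Ssimplex" "m > 0"
  shows "bern_mean m x (\<lambda>k. (norm (grid_point m k - x))\<^sup>2) \<le> real CARD('d) / m"
proof -
  have "(x $ i - x $ i * x $ i) / m \<le> 1 / m" for i
    using bernoulli_variance_bounds(2)[OF assms(1), of i] by (intro divide_right_mono) (auto simp: algebra_simps)
  then have "(\<Sum>i\<in>UNIV. (x $ i - x $ i * x $ i) / m) \<le> (\<Sum>i\<in>(UNIV::'d set). 1 / m)" by (rule sum_mono)
  then show ?thesis
    unfolding power2_norm_vec bern_mean_sum unfolding power2_eq_square grid_point_cov[OF assms] by simp
qed

lemma grid_point_fourth_moment:
  fixes x :: "real^'d"
  assumes "x \<in> Ssimplex" "m > 0"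
  shows "bern_mean m x (\<lambda>k. (norm (grid_point m k - x)) ^ 4) \<le> 4 * (real CARD('d))\<^sup>2 / (real m)\<^sup>2"
proof -
  have "bern_mean m x (\<lambda>k. ((grid_point m k - x) $ i) ^ 4) \<le> 4 / (real m)\<^sup>2" for i
  proof -
    have "bern_mean m x (\<lambda>k. ((grid_point m k - x) $ i) ^ 4) \<le> 4 * (real m)\<^sup>2 / (real m) ^ 4"
      unfolding grid_point_diff[OF assms(2)] power_divide bern_mean_divide
      by (intro divide_right_mono bern_mean_fourth_moment assms) simp
    also have "\<dots> = 4 / (real m)\<^sup>2" using assms(2) by (simp add: field_simps power2_eq_square power4_eq_xxxx)
    finally show ?thesis .
  qed
  then have "(\<Sum>i\<in>UNIV. bern_mean m x (\<lambda>k. ((grid_point m k - x) $ i) ^ 4)) \<le> (\<Sum>i\<in>(UNIV::'d set). 4 / (real m)\<^sup>2)"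
    by (rule sum_mono)
  then have "real CARD('d) * (\<Sum>i\<in>UNIV. bern_mean m x (\<lambda>k. ((grid_point m k - x) $ i) ^ 4)) \<le> real CARD('d) * (real CARD('d) * (4 / (real m)\<^sup>2))"
    by (intro mult_left_mono) auto
  moreover have "bern_mean m x (\<lambda>k. (norm (grid_point m k - x)) ^ 4)
     \<le> bern_mean m x (\<lambda>k. real CARD('d) * (\<Sum>i\<in>UNIV. ((grid_point m k - x) $ i) ^ 4))"
    by (intro bern_mean_mono assms power4_norm_vec_le)
  moreover have "real CARD('d) * (real CARD('d) * (4 / (real m)\<^sup>2)) = 4 * (real CARD('d))\<^sup>2 / (real m)\<^sup>2"
    by (simp add: power2_eq_square)
  ultimately show ?thesis
    unfolding bern_mean_cmult bern_mean_sum by linarith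
qed

text \<open>The upper bound provides the \<open>m\<close>-independent majorant needed for dominated
  convergence; it trades the absolute value for variances.\<close>

lemma mean_gap_bounds:
  fixes x :: "real^'d"
  assumes x: "x \<in> Ssimplex"
  shows "0 \<le> mean_gap m x i" "mean_gap m x i \<le> sqrt m"
proof -
  show "0 \<le> mean_gap m x i" unfolding mean_gap_def by (intro bern_mean_nonneg x) auto
  show "mean_gap m x i \<le> sqrt m"
  proof (cases "m = 0")
    case False
    define Y where "Y k = real (k $ i) - m * x $ i" for k :: "nat^'d"
    have "bern_mean m x (\<lambda>k. (Y k)\<^sup>2) = m * (x $ i * (1 - x $ i))"
      using bern_cov[OF x, of m i i] by (simp add: Y_def power2_eq_square algebra_simps)
    also have "\<dots> \<le> m * (1 / 4)" by (intro mult_left_mono bernoulli_variance_bounds x) simp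
    finally have Y2: "bern_mean m x (\<lambda>k. (Y k)\<^sup>2) \<le> m / 4" by simp
    have le: "\<bar>real (k $ i) - real (l $ i)\<bar> \<le> (Y k)\<^sup>2 / sqrt m + (Y l)\<^sup>2 / sqrt m + sqrt m / 2" for k l
    proof -
      \<comment> \<open>The weight \<open>sqrt m\<close> balances the two summands, as the
        deviations have variance of order \<open>m\<close>.\<close>
      have am_gm: "\<bar>u\<bar> \<le> u\<^sup>2 / (2 * sqrt m) + sqrt m / 2" for u :: real
      proof -
        have "0 \<le> (\<bar>u\<bar> - sqrt m)\<^sup>2" by simp
        then have "2 * sqrt m * \<bar>u\<bar> \<le> u\<^sup>2 + sqrt m * sqrt m" by (simp add: power2_diff mult.commute mult.left_commute)
        then show ?thesis using False by (simp add: field_simps)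
      qed
      have "(Y k - Y l)\<^sup>2 \<le> 2 * (Y k)\<^sup>2 + 2 * (Y l)\<^sup>2"
        using zero_le_power2[of "Y k + Y l"] by (simp add: power2_sum power2_diff)
      then have "(Y k - Y l)\<^sup>2 / (2 * sqrt m) \<le> (2 * (Y k)\<^sup>2 + 2 * (Y l)\<^sup>2) / (2 * sqrt m)"
        by (intro divide_right_mono) auto
      then show ?thesis using am_gm[of "Y k - Y l"] by (simp add: Y_def add_divide_distrib)
    qed
    have "mean_gap m x i \<le> bern_mean m x (\<lambda>k. bern_mean m x (\<lambda>l. (Y k)\<^sup>2 / sqrt m + (Y l)\<^sup>2 / sqrt m + sqrt m / 2))"
      unfolding mean_gap_def by (intro bern_mean_mono x le)
    also have "\<dots> = 2 * bern_mean m x (\<lambda>k. (Y k)\<^sup>2) / sqrt m + sqrt m / 2"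
      by (simp add: bern_mean_add bern_mean_divide x)
    also have "\<dots> \<le> 2 * (m / 4) / sqrt m + sqrt m / 2"
      using Y2 by (intro add_mono divide_right_mono) auto
    also have "\<dots> = sqrt m" using False by (simp add: real_div_sqrt field_simps)
    finally show ?thesis .
  qed (simp add: mean_gap_def)
qed

text \<open>Since \<open>min a b = (a + b) / 2 - \<bar>a - b\<bar> / 2\<close> and the grid points
  have mean \<open>x\<close>, only the absolute difference survives. This drift of order
  \<open>1 / sqrt m\<close> is the source of \<open>Vfun\<close> and of its minus sign.\<close>

lemma min_grid_point_mean:
  assumes x: "x \<in> Ssimplex" and m: "m > 0"
  shows "bern_mean m x (\<lambda>k. bern_mean m x (\<lambda>l. (min_vec (grid_point m k) (grid_point m l) - x) $ i))
     = - mean_gap m x i / (2 * m)"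
proof -
  have "(min_vec (grid_point m k) (grid_point m l) - x) $ i
     = (grid_point m k - x) $ i / 2 + (grid_point m l - x) $ i / 2 - \<bar>real (k $ i) - real (l $ i)\<bar> / (2 * m)" for k l
    using m by (auto simp: min_vec_def grid_point_def min_def abs_if field_simps)
  then show ?thesis
    by (simp only: bern_mean_add bern_mean_diff bern_mean_divide mean_gap_def bern_mean_const[OF x] grid_point_mean[OF x m])
qed

lemma min_grid_point_second_moment:
  fixes x :: "real^'d"
  assumes x: "x \<in> Ssimplex" and m: "m > 0"
  shows "bern_mean m x (\<lambda>k. bern_mean m x (\<lambda>l. (norm (min_vec (grid_point m k) (grid_point m l) - x))\<^sup>2))
     \<le> 2 * real CARD('d) / m"
proof -
  \<comment> \<open>Each coordinate of the minimum is a coordinate of \<open>a\<close> or of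
    \<open>b\<close>, so one of the two squares accounts for it.\<close>
  have "(norm (min_vec a b - x))\<^sup>2 \<le> (norm (a - x))\<^sup>2 + (norm (b - x))\<^sup>2" for a b
    unfolding power2_norm_vec sum.distrib[symmetric]
    by (intro sum_mono) (auto simp: min_vec_def min_def)
  then have "bern_mean m x (\<lambda>k. bern_mean m x (\<lambda>l. (norm (min_vec (grid_point m k) (grid_point m l) - x))\<^sup>2))
    \<le> bern_mean m x (\<lambda>k. bern_mean m x (\<lambda>l. (norm (grid_point m k - x))\<^sup>2 + (norm (grid_point m l - x))\<^sup>2))"
    by (intro bern_mean_mono x)
  also have "\<dots> = 2 * bern_mean m x (\<lambda>k. (norm (grid_point m k - x))\<^sup>2)"
    by (simp add: bern_mean_add x)
  also have "\<dots> \<le> 2 * (real CARD('d) / m)"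
    by (intro mult_left_mono grid_point_second_moment x m) simp
  finally show ?thesis by simp
qed

section \<open>Tools for integrating limits over the simplex\<close>

lemma continuous_on_bernP: "continuous_on A (bernP k m)"
  unfolding bernP_def l1norm_def by (intro continuous_intros)

lemma continuous_on_bern_fun: "continuous_on A (bern_fun m F)"
  unfolding bern_fun_def bern_mean_def by (intro continuous_intros continuous_on_bernP)

lemma continuous_on_bern_min: "continuous_on A (bern_min m F)"
  unfolding bern_min_def bern_mean_def by (intro continuous_intros continuous_on_bernP)

lemma set_integrable_Ssimplex:
  "continuous_on Ssimplex f \<Longrightarrow> set_integrable lborel Ssimplex (f :: real^'d \<Rightarrow> real)"
  unfolding set_integrable_def by (intro borel_integrable_compact compact_Ssimplex)

lemma dominated_convergence_Ssimplex:
  fixes f :: "real^'d \<Rightarrow> real"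
  assumes cont: "\<And>m. continuous_on Ssimplex (g m)" "continuous_on Ssimplex f"
    and lim: "\<And>x. x \<in> Ssimplex \<Longrightarrow> (\<lambda>m. g m x) \<longlonglongrightarrow> f x"
    and bound: "\<And>m x. x \<in> Ssimplex \<Longrightarrow> \<bar>g m x\<bar> \<le> C"
  shows "(\<lambda>m. LINT x:Ssimplex|lborel. g m x) \<longlonglongrightarrow> (LINT x:Ssimplex|lborel. f x)"
  unfolding set_lebesgue_integral_def
proof (rule integral_dominated_convergence[where w="\<lambda>x. indicator Ssimplex x *\<^sub>R C"])
  note int = set_integrable_Ssimplex[unfolded set_integrable_def]
  show "integrable lborel (\<lambda>x::real^'d. indicator Ssimplex x *\<^sub>R C)" by (rule int) simp
  show "(\<lambda>x. indicator Ssimplex x *\<^sub>R f x) \<in> borel_measurable lborel"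
    "(\<lambda>x. indicator Ssimplex x *\<^sub>R g m x) \<in> borel_measurable lborel" for m
    using int[OF cont(2)] int[OF cont(1)] by (blast intro: borel_measurable_integrable)+
  show "AE x in lborel. (\<lambda>m. indicator Ssimplex x *\<^sub>R g m x) \<longlonglongrightarrow> indicator Ssimplex x *\<^sub>R f x"
    using lim by (intro AE_I2) (auto simp: indicator_def)
  show "AE x in lborel. norm (indicator Ssimplex x *\<^sub>R g m x) \<le> indicator Ssimplex x *\<^sub>R C" for m
    using bound by (intro AE_I2) (auto simp: indicator_def)
qed

lemma LIMSEQ_of_rate:
  fixes f :: "nat \<Rightarrow> real"
  assumes "\<And>m. m > 0 \<Longrightarrow> \<bar>f m - a\<bar> \<le> C / sqrt m"
  shows "f \<longlonglongrightarrow> a"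
proof (rule LIM_zero_cancel, rule Lim_null_comparison)
  show "\<forall>\<^sub>F m in sequentially. norm (f m - a) \<le> C / sqrt (real m)"
    using eventually_gt_at_top[of 0] by eventually_elim (use assms in auto)
  show "(\<lambda>m. C / sqrt (real m)) \<longlonglongrightarrow> 0" by real_asymp
qed

context smooth_on_simplex
begin

lemma bern_mean_grad: "bern_mean m x (\<lambda>k. grad x (h k)) = grad x (\<chi> i. bern_mean m x (\<lambda>k. h k $ i))"
  unfolding grad_def bern_mean_sum bern_mean_multc by simp

lemma bern_mean_hess:
  assumes "x \<in> Ssimplex" "m > 0"
  shows "bern_mean m x (\<lambda>k. hess x (grid_point m k - x) / 2) = Bfun D2 x / m"
  unfolding bern_mean_divide hess_def bern_mean_sum bern_mean_multc grid_point_cov[OF assms]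
  by (simp add: Bfun_def sum_divide_distrib[symmetric])

lemma bern_mean_grad_grid:
  assumes "x \<in> Ssimplex" "m > 0"
  shows "bern_mean m x (\<lambda>k. grad x (grid_point m k - x)) = 0"
  unfolding bern_mean_grad grid_point_mean[OF assms] by (simp add: grad_def)

text \<open>The linear Taylor term averages to zero because the grid points have mean
  \<open>x\<close>. Uniformity in \<open>x\<close> yields the majorant for the squared bias and
  makes the bias negligible inside the variance.\<close>

lemma bern_fun_error:
  obtains C where "C \<ge> 0" "\<And>m x. x \<in> Ssimplex \<Longrightarrow> m > 0 \<Longrightarrow> \<bar>bern_fun m G x - G x\<bar> \<le> C / m"
proof -
  obtain C where C: "C \<ge> 0" "\<And>x y. x \<in> Ssimplex \<Longrightarrow> y \<in> Ssimplex \<Longrightarrow>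
    \<bar>G y - G x - grad x (y - x)\<bar> \<le> C * (norm (y - x))\<^sup>2" by (rule taylor_first_order) blast
  show ?thesis
  proof (rule that[of "C * CARD('d)"])
    fix m :: nat and x :: "real^'d" assume x: "x \<in> Ssimplex" and m: "m > 0"
    have "bern_fun m G x - G x = bern_mean m x (\<lambda>k. G (grid_point m k) - G x - grad x (grid_point m k - x))"
      unfolding bern_mean_grad_grid[OF x m] bern_mean_diff by (simp add: bern_fun_def x)
    also have "\<bar>\<dots>\<bar> \<le> bern_mean m x (\<lambda>k. C * (norm (grid_point m k - x))\<^sup>2)"
      by (intro order_trans[OF bern_mean_abs_le[OF x]] bern_mean_mono x C grid_point_in_Ssimplex)
    also have "\<dots> \<le> C * (real CARD('d) / m)"
      unfolding bern_mean_cmult by (intro mult_left_mono grid_point_second_moment x m C)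
    finally show "\<bar>bern_fun m G x - G x\<bar> \<le> C * CARD('d) / m" by simp
  qed (use C in simp)
qed

lemma bern_fun_limit:
  assumes x: "x \<in> Ssimplex"
  shows "(\<lambda>m. real m * (bern_fun m G x - G x)) \<longlonglongrightarrow> Bfun D2 x"
proof (rule tendstoI)
  fix e :: real assume e: "e > 0"
  define N where "N = real CARD('d)"
  have N: "N > 0" by (simp add: N_def)
  \<comment> \<open>The tolerance \<open>e / (2 * N)\<close> cancels the dimension factor of the
    second moment. After scaling by \<open>m\<close> this term contributes \<open>e / 2\<close>, and
    the quartic one is O(1/m).\<close>
  obtain C where C: "C \<ge> 0" "\<And>x y. x \<in> Ssimplex \<Longrightarrow> y \<in> Ssimplex \<Longrightarrow>
    \<bar>G y - G x - grad x (y - x) - hess x (y - x) / 2\<bar> \<le> e / (2 * N) * (norm (y - x))\<^sup>2 + C * (norm (y - x)) ^ 4"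
    using taylor_second_order[of "e / (2 * N)"] e N by auto
  have bound: "\<bar>real m * (bern_fun m G x - G x) - Bfun D2 x\<bar> \<le> e / 2 + 4 * C * N\<^sup>2 / m" if m: "m > 0" for m
  proof -
    have "bern_fun m G x - G x - Bfun D2 x / m
       = bern_mean m x (\<lambda>k. G (grid_point m k) - G x - grad x (grid_point m k - x) - hess x (grid_point m k - x) / 2)"
      unfolding bern_mean_hess[OF x m]
        bern_mean_grad_grid[OF x m] bern_mean_diff
      by (simp add: bern_fun_def x)
    also have "\<bar>\<dots>\<bar> \<le> bern_mean m x (\<lambda>k. e / (2 * N) * (norm (grid_point m k - x))\<^sup>2 + C * (norm (grid_point m k - x)) ^ 4)"
      by (intro order_trans[OF bern_mean_abs_le[OF x]] bern_mean_mono x C grid_point_in_Ssimplex)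
    also have "\<dots> \<le> e / (2 * N) * (N / m) + C * (4 * N\<^sup>2 / (real m)\<^sup>2)"
      unfolding bern_mean_add bern_mean_cmult N_def using e
      by (intro add_mono mult_left_mono grid_point_second_moment grid_point_fourth_moment x m C) auto
    finally have "real m * \<bar>bern_fun m G x - G x - Bfun D2 x / m\<bar> \<le> real m * (e / (2 * N) * (N / m) + C * (4 * N\<^sup>2 / (real m)\<^sup>2))"
      by (intro mult_left_mono) auto
    also have "\<dots> = e / 2 + 4 * C * N\<^sup>2 / m"
      using m N by (simp add: field_simps power2_eq_square)
    also have "real m * \<bar>bern_fun m G x - G x - Bfun D2 x / m\<bar> = \<bar>real m * (bern_fun m G x - G x) - Bfun D2 x\<bar>"
    proof -
      have "real m * \<bar>bern_fun m G x - G x - Bfun D2 x / m\<bar> = \<bar>real m * (bern_fun m G x - G x - Bfun D2 x / m)\<bar>"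
        by (simp add: abs_mult)
      then show ?thesis using m by (simp add: right_diff_distrib)
    qed
    finally show ?thesis .
  qed
  have "(\<lambda>m. 4 * C * N\<^sup>2 / real m) \<longlonglongrightarrow> 0" by real_asymp
  then have "\<forall>\<^sub>F m in sequentially. 4 * C * N\<^sup>2 / real m < e / 2"
    by (rule order_tendstoD) (use e in simp)
  with eventually_gt_at_top[of 0]
  show "\<forall>\<^sub>F m in sequentially. dist (real m * (bern_fun m G x - G x)) (Bfun D2 x) < e"
  proof eventually_elim
    case (elim m)
    then show ?case using bound[of m] by (simp add: dist_real_def)
  qed
qed

text \<open>The mean gap is left unevaluated so that the same estimate serves twice: with
  \<open>mean_gap_limit\<close> for the pointwise limit and with \<open>mean_gap_bounds\<close> for
  the majorant.\<close>

lemma bern_min_error: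
  obtains C where "C \<ge> 0" "\<And>m x. x \<in> Ssimplex \<Longrightarrow> m > 0 \<Longrightarrow>
    \<bar>sqrt m * (bern_min m G x - G x) + (\<Sum>i\<in>UNIV. mean_gap m x i / sqrt m / 2 * D1 i x)\<bar> \<le> C / sqrt m"
proof -
  obtain C where C: "C \<ge> 0" "\<And>x y. x \<in> Ssimplex \<Longrightarrow> y \<in> Ssimplex \<Longrightarrow>
    \<bar>G y - G x - grad x (y - x)\<bar> \<le> C * (norm (y - x))\<^sup>2" by (rule taylor_first_order) blast
  show ?thesis
  proof (rule that[of "2 * C * CARD('d)"])
    fix m :: nat and x :: "real^'d" assume x: "x \<in> Ssimplex" and m: "m > 0"
    let ?v = "\<lambda>k l. min_vec (grid_point m k) (grid_point m l)"
    have scale: "sqrt m * (mean_gap m x i / (2 * m) * D1 i x) = mean_gap m x i / sqrt m / 2 * D1 i x" for i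
      using m real_sqrt_mult_self[of m] by (simp add: field_simps)
    have "bern_min m G x - G x + (\<Sum>i\<in>UNIV. mean_gap m x i / (2 * m) * D1 i x)
      = bern_mean m x (\<lambda>k. bern_mean m x (\<lambda>l. G (?v k l) - G x - grad x (?v k l - x)))"
      unfolding bern_mean_diff bern_mean_grad
      by (simp only: bern_mean_const[OF x] vec_lambda_beta min_grid_point_mean[OF x m])
        (simp add: bern_min_def grad_def sum_negf)
    also have "\<bar>\<dots>\<bar> \<le> bern_mean m x (\<lambda>k. bern_mean m x (\<lambda>l. C * (norm (?v k l - x))\<^sup>2))"
      by (intro order_trans[OF bern_mean_abs_le[OF x]] bern_mean_mono x C grid_point_in_Ssimplex min_vec_in_Ssimplex)
    also have "\<dots> \<le> C * (2 * real CARD('d) / m)"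
      unfolding bern_mean_cmult by (intro mult_left_mono min_grid_point_second_moment x m C)
    finally have "sqrt m * \<bar>bern_min m G x - G x + (\<Sum>i\<in>UNIV. mean_gap m x i / (2 * m) * D1 i x)\<bar> \<le> sqrt m * (C * (2 * real CARD('d) / m))"
      by (intro mult_left_mono) auto
    also have "\<dots> = 2 * C * CARD('d) / sqrt m"
      using m real_sqrt_mult_self[of m] by (simp add: field_simps)
    also have "sqrt m * \<bar>bern_min m G x - G x + (\<Sum>i\<in>UNIV. mean_gap m x i / (2 * m) * D1 i x)\<bar>
      = \<bar>sqrt m * (bern_min m G x - G x) + (\<Sum>i\<in>UNIV. mean_gap m x i / sqrt m / 2 * D1 i x)\<bar>"
      unfolding scale[symmetric] sum_distrib_left[symmetric] distrib_left[symmetric] by (simp add: abs_mult)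
    finally show "\<bar>sqrt m * (bern_min m G x - G x) + (\<Sum>i\<in>UNIV. mean_gap m x i / sqrt m / 2 * D1 i x)\<bar> \<le> 2 * C * CARD('d) / sqrt m" .
  qed (use C in simp)
qed

lemma bern_min_limit:
  assumes x: "x \<in> Ssimplex"
  shows "(\<lambda>m. sqrt m * (bern_min m G x - G x)) \<longlonglongrightarrow> - Vfun D1 x"
proof -
  obtain C where C: "C \<ge> 0" "\<And>m x. x \<in> Ssimplex \<Longrightarrow> m > 0 \<Longrightarrow>
    \<bar>sqrt m * (bern_min m G x - G x) + (\<Sum>i\<in>UNIV. mean_gap m x i / sqrt m / 2 * D1 i x)\<bar> \<le> C / sqrt m"
    by (rule bern_min_error) blast
  have 1: "(\<lambda>m. sqrt m * (bern_min m G x - G x) + (\<Sum>i\<in>UNIV. mean_gap m x i / sqrt m / 2 * D1 i x)) \<longlonglongrightarrow> 0"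
    using C(2)[OF x] by (intro LIMSEQ_of_rate) auto
  have "(\<lambda>m. \<Sum>i\<in>UNIV. mean_gap m x i / sqrt m / 2 * D1 i x)
     \<longlonglongrightarrow> (\<Sum>i\<in>UNIV. 2 * sqrt (x $ i * (1 - x $ i) / pi) / 2 * D1 i x)"
    by (intro tendsto_sum tendsto_mult tendsto_divide tendsto_const mean_gap_limit x) simp
  from tendsto_diff[OF 1 this] show ?thesis by (simp add: Vfun_def mult.commute)
qed

lemma bern_min_bound:
  obtains C where "\<And>m x. x \<in> Ssimplex \<Longrightarrow> \<bar>sqrt m * (bern_min m G x - G x)\<bar> \<le> C"
proof -
  obtain C where C: "C \<ge> 0" "\<And>m x. x \<in> Ssimplex \<Longrightarrow> m > 0 \<Longrightarrow>
    \<bar>sqrt m * (bern_min m G x - G x) + (\<Sum>i\<in>UNIV. mean_gap m x i / sqrt m / 2 * D1 i x)\<bar> \<le> C / sqrt m"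
    by (rule bern_min_error) blast
  obtain B where B: "B \<ge> 0" "\<And>i x. x \<in> Ssimplex \<Longrightarrow> \<bar>D1 i x\<bar> \<le> B"
    using continuous_on_Ssimplex_bounded[of D1] continuous_on_D1 by blast
  have "\<bar>sqrt m * (bern_min m G x - G x)\<bar> \<le> C + CARD('d) * B" if x: "x \<in> Ssimplex" for m x
  proof (cases "m = 0")
    case False
    have "\<bar>mean_gap m x i / sqrt m / 2 * D1 i x\<bar> \<le> 1 * B" for i
      unfolding abs_mult using mean_gap_bounds[OF x, of m i] False B(2)[OF x, of i] by (intro mult_mono) auto
    then have "(\<Sum>i\<in>UNIV. \<bar>mean_gap m x i / sqrt m / 2 * D1 i x\<bar>) \<le> (\<Sum>i\<in>(UNIV::'d set). 1 * B)"
      by (rule sum_mono)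
    then have "\<bar>\<Sum>i\<in>UNIV. mean_gap m x i / sqrt m / 2 * D1 i x\<bar> \<le> CARD('d) * B"
      using sum_abs[of "\<lambda>i. mean_gap m x i / sqrt m / 2 * D1 i x" UNIV] by simp
    moreover have "C / sqrt m \<le> C" using False C(1) by (simp add: divide_le_eq mult_left_le_one_le mult_le_cancel_left1)
    ultimately show ?thesis using C(2)[OF x, of m] False by linarith
  qed (use C B in simp)
  then show ?thesis by (rule that)
qed

section \<open>Limits of the integrated bias and variance\<close>

lemma continuous_on_Bfun: "continuous_on Ssimplex (Bfun D2)"
  unfolding Bfun_def by (intro continuous_intros continuous_on_D2) (rename_tac i j, case_tac "i = j", auto intro!: continuous_intros)

lemma continuous_on_Vfun: "continuous_on Ssimplex (Vfun D1)"
  unfolding Vfun_def by (intro continuous_intros continuous_on_D1) auto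

lemma continuous_on_sigma2: "continuous_on Ssimplex (sigma2 G)"
  unfolding sigma2_def by (intro continuous_intros continuous_on_G)

lemma bias_integral_limit:
  "(\<lambda>m. LINT x:Ssimplex|lborel. (real m * (bern_fun m G x - G x))\<^sup>2) \<longlonglongrightarrow> (LINT x:Ssimplex|lborel. (Bfun D2 x)\<^sup>2)"
proof -
  obtain C where C: "C \<ge> 0" "\<And>m x. x \<in> Ssimplex \<Longrightarrow> m > 0 \<Longrightarrow> \<bar>bern_fun m G x - G x\<bar> \<le> C / m"
    by (rule bern_fun_error) blast
  have "\<bar>real m * (bern_fun m G x - G x)\<bar> \<le> C" if "x \<in> Ssimplex" for m x
    using C(1) C(2)[OF that, of m] by (cases "m = 0") (simp_all add: abs_mult pos_le_divide_eq mult.commute)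
  then have bound: "\<bar>(real m * (bern_fun m G x - G x))\<^sup>2\<bar> \<le> C\<^sup>2" if "x \<in> Ssimplex" for m x
    using that by (simp only: abs_power2) (metis abs_ge_zero power2_abs power_mono)
  show ?thesis
    by (rule dominated_convergence_Ssimplex[OF _ _ _ bound])
      (auto intro!: continuous_intros continuous_on_bern_fun continuous_on_G continuous_on_Bfun tendsto_intros bern_fun_limit)
qed

lemma variance_integral_limit:
  "(\<lambda>m. LINT x:Ssimplex|lborel. sqrt m * (bern_min m G x - (bern_fun m G x)\<^sup>2 - sigma2 G x))
     \<longlonglongrightarrow> - (LINT x:Ssimplex|lborel. Vfun D1 x)"
proof -
  obtain C where C: "C \<ge> 0" "\<And>m x. x \<in> Ssimplex \<Longrightarrow> m > 0 \<Longrightarrow> \<bar>bern_fun m G x - G x\<bar> \<le> C / m"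
    by (rule bern_fun_error) blast
  obtain K where K: "\<And>m x. x \<in> Ssimplex \<Longrightarrow> \<bar>sqrt m * (bern_min m G x - G x)\<bar> \<le> K"
    by (rule bern_min_bound) blast
  obtain B where B: "B \<ge> 0" "\<And>x. x \<in> Ssimplex \<Longrightarrow> \<bar>G x\<bar> \<le> B"
    by (rule continuous_on_Ssimplex_bounded[of "\<lambda>_::unit. G"]) (rule continuous_on_G, blast)
  \<comment> \<open>The part of the variance caused by squaring \<open>bern_fun\<close> instead of
    \<open>G\<close>. It factors into the bias, O(1/m), times a bounded sum, and so vanishes even
    after scaling by \<open>sqrt m\<close>.\<close>
  define s where "s m x = sqrt (real m) * ((bern_fun m G x)\<^sup>2 - (G x)\<^sup>2)" for m x
  have s_bound: "\<bar>s m x\<bar> \<le> C * (2 * B) / sqrt m" if x: "x \<in> Ssimplex" for m x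
  proof (cases "m = 0")
    case False
    have "\<bar>bern_fun m G x\<bar> \<le> bern_mean m x (\<lambda>k. B)"
      unfolding bern_fun_def
      by (intro order_trans[OF bern_mean_abs_le[OF x]] bern_mean_mono x B grid_point_in_Ssimplex)
    then have "\<bar>bern_fun m G x + G x\<bar> \<le> 2 * B" using B(2)[OF x] x by simp
    then have "\<bar>bern_fun m G x - G x\<bar> * \<bar>bern_fun m G x + G x\<bar> \<le> C / m * (2 * B)"
      using C(1) C(2)[OF x, of m] False by (intro mult_mono) auto
    then have le: "sqrt m * (\<bar>bern_fun m G x - G x\<bar> * \<bar>bern_fun m G x + G x\<bar>) \<le> sqrt m * (C / m * (2 * B))"
      by (rule mult_left_mono) simp
    have "\<bar>s m x\<bar> = sqrt m * (\<bar>bern_fun m G x - G x\<bar> * \<bar>bern_fun m G x + G x\<bar>)"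
      by (simp add: s_def abs_mult power2_eq_square square_diff_square_factored)
    also have "\<dots> \<le> sqrt m * (C / m * (2 * B))" by (rule le)
    also have "\<dots> = C * (2 * B) / sqrt m" using False real_sqrt_mult_self[of m] by (simp add: field_simps)
    finally show ?thesis .
  qed (simp add: s_def)
  have s_lim: "(\<lambda>m. s m x) \<longlonglongrightarrow> 0" if "x \<in> Ssimplex" for x
    using s_bound[OF that] by (intro LIMSEQ_of_rate) auto
  have s_bound': "\<bar>s m x\<bar> \<le> C * (2 * B)" if "x \<in> Ssimplex" for m x
  proof (cases "m = 0")
    case False
    then have "C * (2 * B) / sqrt m \<le> C * (2 * B) / 1" using C(1) B(1) by (intro divide_left_mono) auto
    then show ?thesis using s_bound[OF that, of m] by simp
  qed (use C B in \<open>simp add: s_def\<close>)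
  have eq: "sqrt m * (bern_min m G x - (bern_fun m G x)\<^sup>2 - sigma2 G x) = sqrt m * (bern_min m G x - G x) - s m x" for m x
    by (simp add: s_def sigma2_def power2_eq_square algebra_simps)
  have "(\<lambda>m. LINT x:Ssimplex|lborel. sqrt m * (bern_min m G x - (bern_fun m G x)\<^sup>2 - sigma2 G x))
     \<longlonglongrightarrow> (LINT x:Ssimplex|lborel. - Vfun D1 x)"
  proof (rule dominated_convergence_Ssimplex)
    show "continuous_on Ssimplex (\<lambda>x. sqrt m * (bern_min m G x - (bern_fun m G x)\<^sup>2 - sigma2 G x))" for m :: nat
      by (intro continuous_intros continuous_on_bern_min continuous_on_bern_fun continuous_on_sigma2)
    show "continuous_on Ssimplex (\<lambda>x. - Vfun D1 x)"
      by (intro continuous_intros continuous_on_Vfun)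
    fix x :: "real^'d" assume x: "x \<in> Ssimplex"
    show "(\<lambda>m. sqrt m * (bern_min m G x - (bern_fun m G x)\<^sup>2 - sigma2 G x)) \<longlonglongrightarrow> - Vfun D1 x"
      using tendsto_diff[OF bern_min_limit[OF x] s_lim[OF x]] unfolding eq by simp
    show "\<bar>sqrt m * (bern_min m G x - (bern_fun m G x)\<^sup>2 - sigma2 G x)\<bar> \<le> K + C * (2 * B)" for m :: nat
      unfolding eq using K[OF x, of m] s_bound'[OF x, of m] by linarith
  qed
  then show ?thesis by (simp add: set_lebesgue_integral_def)
qed

end

section \<open>Expansion of the MISE\<close>

text \<open>\<open>F\<close> is the distribution function on the whole space and \<open>G\<close>
  its smooth companion; they are tied together on the simplex only.\<close>

locale bernstein_cdf = smooth_on_simplex U G D1 D2 + M: prob_space M + mu: prob_space \<mu>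
  for U :: "(real^'d) set" and G :: "real^'d \<Rightarrow> real"
    and D1 :: "'d \<Rightarrow> real^'d \<Rightarrow> real" and D2 :: "'d \<Rightarrow> 'd \<Rightarrow> real^'d \<Rightarrow> real"
    and M :: "'a measure" and \<mu> :: "(real^'d) measure" +
  fixes X :: "nat \<Rightarrow> 'a \<Rightarrow> real^'d" and F :: "real^'d \<Rightarrow> real"
  assumes sets_mu: "sets \<mu> = sets borel"
    and F_cdf: "\<And>x. F x = measure \<mu> {y. \<forall>j. y $ j \<le> x $ j}"
    and X_meas: "\<And>i. X i \<in> borel_measurable M"
    and X_dist: "\<And>i. distr M borel (X i) = \<mu>"
    and X_indep: "prob_space.indep_vars M (\<lambda>_. borel) X UNIV"
    and G_eq_F: "\<And>x. x \<in> Ssimplex \<Longrightarrow> G x = F x"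
begin

definition "IS = (LINT x:Ssimplex|lborel. sigma2 F x)"
definition "IV = (LINT x:Ssimplex|lborel. Vfun D1 x)"
definition "IB = (LINT x:Ssimplex|lborel. (Bfun D2 x)\<^sup>2)"

definition var_remainder :: "nat \<Rightarrow> real" where
  "var_remainder m = (LINT x:Ssimplex|lborel. sqrt m * (bern_min m G x - (bern_fun m G x)\<^sup>2 - sigma2 G x))"

definition scaled_bias :: "nat \<Rightarrow> real" where
  "scaled_bias m = (LINT x:Ssimplex|lborel. (real m * (bern_fun m G x - G x))\<^sup>2)"

lemma Ssimplex_borel: "(Ssimplex :: (real^'d) set) \<in> sets lborel"
  using borel_compact[OF compact_Ssimplex] by simp

lemma bern_fun_cong: "bern_fun m F x = bern_fun m G x"
  unfolding bern_fun_def bern_mean_def by (simp add: G_eq_F grid_point_in_Ssimplex)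

lemma bern_min_cong: "bern_min m F x = bern_min m G x"
  unfolding bern_min_def bern_mean_def
  by (simp add: G_eq_F grid_point_in_Ssimplex min_vec_in_Ssimplex)

text \<open>An exact identity. All asymptotics are confined to two sequences that depend on
  \<open>m\<close> alone and converge, so any degree sequence tending to infinity can be substituted
  afterwards.\<close>

lemma MISE_decomposition:
  assumes n: "n > 0" and m: "m > 0"
  shows "MISE M X F n m = IS / n + var_remainder m / (n * sqrt m) + scaled_bias m / (real m)\<^sup>2"
proof -
  let ?w = "\<lambda>x. sqrt m * (bern_min m G x - (bern_fun m G x)\<^sup>2 - sigma2 G x)"
  let ?q = "\<lambda>x. (real m * (bern_fun m G x - G x))\<^sup>2"
  have int: "set_integrable lborel Ssimplex ?w" "set_integrable lborel Ssimplex ?q" "set_integrable lborel Ssimplex (sigma2 G)"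
    by (intro set_integrable_Ssimplex continuous_intros continuous_on_bern_fun continuous_on_bern_min
        continuous_on_G continuous_on_sigma2)+
  have eq: "(LINT \<omega>|M. (Fstar X n m x \<omega> - F x)\<^sup>2)
      = 1 / n * sigma2 G x + 1 / (n * sqrt m) * ?w x + 1 / (real m)\<^sup>2 * ?q x" if x: "x \<in> Ssimplex" for x
  proof -
    have "(LINT \<omega>|M. (Fstar X n m x \<omega> - F x)\<^sup>2)
        = (bern_min m F x - (bern_fun m F x)\<^sup>2) / n + (bern_fun m F x - F x)\<^sup>2"
      by (rule Fstar_mean_square_error[OF M.prob_space_axioms mu.prob_space_axioms sets_mu F_cdf X_meas X_dist X_indep n x])
    also have "\<dots> = (bern_min m G x - (bern_fun m G x)\<^sup>2) / n + (bern_fun m G x - G x)\<^sup>2"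
      by (simp add: bern_fun_cong bern_min_cong G_eq_F x)
    also have "\<dots> = 1 / n * sigma2 G x + 1 / (n * sqrt m) * ?w x + 1 / (real m)\<^sup>2 * ?q x"
      using m n by (simp add: power_mult_distrib diff_divide_distrib)
    finally show ?thesis .
  qed
  have "MISE M X F n m = (LINT x:Ssimplex|lborel. 1 / n * sigma2 G x + 1 / (n * sqrt m) * ?w x + 1 / (real m)\<^sup>2 * ?q x)"
    unfolding MISE_def by (intro set_lebesgue_integral_cong Ssimplex_borel allI impI eq)
  also have "\<dots> = 1 / n * (LINT x:Ssimplex|lborel. sigma2 G x) + 1 / (n * sqrt m) * (LINT x:Ssimplex|lborel. ?w x) + 1 / (real m)\<^sup>2 * (LINT x:Ssimplex|lborel. ?q x)"
    using int by (simp only: set_integral_add set_integral_mult_right set_integrable_mult_right)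
  also have "(LINT x:Ssimplex|lborel. sigma2 G x) = IS"
    unfolding IS_def by (intro set_lebesgue_integral_cong Ssimplex_borel allI impI) (simp add: sigma2_def G_eq_F)
  finally show ?thesis unfolding var_remainder_def scaled_bias_def by simp
qed

lemma var_remainder_limit: "var_remainder \<longlonglongrightarrow> - IV"
  using variance_integral_limit unfolding IV_def var_remainder_def[abs_def] .

lemma scaled_bias_limit: "scaled_bias \<longlonglongrightarrow> IB"
  using bias_integral_limit unfolding IB_def scaled_bias_def[abs_def] .

theorem MISE_expansion:
  assumes m: "filterlim m at_top sequentially"
  shows "\<exists>r1 r2. r1 \<in> o(\<lambda>n. 1 / (real n * sqrt (real (m n)))) \<and> r2 \<in> o(\<lambda>n. 1 / (real (m n))\<^sup>2) \<and>
     (\<forall>n. MISE M X F n (m n) = 1 / real n * IS - 1 / (real n * sqrt (real (m n))) * IV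
         + 1 / (real (m n))\<^sup>2 * IB + r1 n + r2 n)"
proof (intro exI conjI)
  define r2 where "r2 = (\<lambda>n. (scaled_bias (m n) - IB) / (real (m n))\<^sup>2)"
  define r1 where "r1 = (\<lambda>n. MISE M X F n (m n) - (1 / real n * IS - 1 / (real n * sqrt (real (m n))) * IV
         + 1 / (real (m n))\<^sup>2 * IB) - r2 n)"
  have pos: "\<forall>\<^sub>F n in sequentially. n > 0 \<and> m n > 0"
    using eventually_gt_at_top[of 0] filterlim_at_top[THEN iffD1, OF m, rule_format, of 1]
    by eventually_elim simp
  have w: "(\<lambda>n. var_remainder (m n) + IV) \<longlonglongrightarrow> - IV + IV" and q: "(\<lambda>n. scaled_bias (m n) - IB) \<longlonglongrightarrow> IB - IB"
    by (intro tendsto_intros filterlim_compose[OF var_remainder_limit m] filterlim_compose[OF scaled_bias_limit m])+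
  show "r2 \<in> o(\<lambda>n. 1 / (real (m n))\<^sup>2)"
  proof (rule smalloI_tendsto)
    show "(\<lambda>n. r2 n / (1 / (real (m n))\<^sup>2)) \<longlonglongrightarrow> 0"
      by (rule Lim_transform_eventually[OF q[simplified]]) (use pos in \<open>eventually_elim, simp add: r2_def\<close>)
    show "\<forall>\<^sub>F n in sequentially. 1 / (real (m n))\<^sup>2 \<noteq> 0" using pos by eventually_elim simp
  qed
  show "r1 \<in> o(\<lambda>n. 1 / (real n * sqrt (real (m n))))"
  proof (rule smalloI_tendsto)
    show "(\<lambda>n. r1 n / (1 / (real n * sqrt (real (m n))))) \<longlonglongrightarrow> 0"
    proof (rule Lim_transform_eventually[OF w[simplified]])
      show "\<forall>\<^sub>F n in sequentially. var_remainder (m n) + IV = r1 n / (1 / (real n * sqrt (real (m n))))"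
        using pos
      proof eventually_elim
        case (elim n)
        then have "r1 n = (var_remainder (m n) + IV) / (real n * sqrt (real (m n)))"
          unfolding r1_def r2_def by (subst MISE_decomposition) (auto simp: add_divide_distrib diff_divide_distrib)
        with elim show ?case by simp
      qed
    qed
    show "\<forall>\<^sub>F n in sequentially. 1 / (real n * sqrt (real (m n))) \<noteq> 0" using pos by eventually_elim simp
  qed
  show "\<forall>n. MISE M X F n (m n) = 1 / real n * IS - 1 / (real n * sqrt (real (m n))) * IV
         + 1 / (real (m n))\<^sup>2 * IB + r1 n + r2 n"
    by (simp add: r1_def)
qed

section \<open>Positivity of the integral of V\<close>

lemma F_mono:
  assumes "\<And>j. a $ j \<le> b $ j"
  shows "F a \<le> F b"
proof -
  have "{y. \<forall>j. y $ j \<le> b $ j} \<in> sets \<mu>"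
    using lower_orthant_borel[of b] sets_mu by (simp add: lower_orthant_def)
  then show ?thesis unfolding F_cdf
    using assms by (intro mu.finite_measure_mono) (auto intro: order_trans)
qed

text \<open>A negative derivative would make \<open>G\<close> larger slightly to the left.
  Decreasing a positive coordinate never leaves the simplex, not even from the face
  \<open>l1norm x = 1\<close>, so this contradicts the monotonicity of \<open>F\<close>.\<close>

lemma D1_nonneg:
  assumes x: "x \<in> Ssimplex" and pos: "0 < x $ i"
  shows "0 \<le> D1 i x"
proof (rule ccontr)
  assume neg: "\<not> 0 \<le> D1 i x"
  have "has_partial G i (D1 i x) x" using C2 U x by (auto simp: C2_partials_def)
  then obtain d where d: "d > 0" "\<And>h. 0 < h \<Longrightarrow> h < d \<Longrightarrow> G (x + 0 *\<^sub>R axis i 1) < G (x + (0 - h) *\<^sub>R axis i 1)"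
    unfolding has_partial_def using DERIV_neg_dec_left[of "\<lambda>t. G (x + t *\<^sub>R axis i 1)" "D1 i x" 0] neg by auto
  \<comment> \<open>Half of \<open>d\<close> gives the strict inequality; the cap at
    \<open>x $ i\<close> keeps the coordinate nonnegative.\<close>
  define h where "h = min (d / 2) (x $ i)"
  have h: "0 < h" "h < d" "h \<le> x $ i" using d pos by (auto simp: h_def)
  let ?y = "x - h *\<^sub>R axis i 1"
  have y: "0 \<le> ?y $ j" "?y $ j \<le> x $ j" for j
    using h Ssimplex_nonneg[OF x, of j] by (auto simp: axis_def)
  have "l1norm ?y \<le> l1norm x"
    unfolding l1norm_def using y Ssimplex_nonneg[OF x] by (intro sum_mono) (metis abs_of_nonneg)
  then have yS: "?y \<in> Ssimplex"
    unfolding Ssimplex_def mem_Collect_eq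
    using y order_trans[OF y(2) Ssimplex_le_1[OF x]] x by (auto simp: Ssimplex_def simp del: vector_minus_component)
  have "G x < G ?y" using d(2)[OF h(1,2)] by simp
  moreover have "F ?y \<le> F x" by (rule F_mono) (rule y)
  ultimately show False using G_eq_F[OF x] G_eq_F[OF yS] by simp
qed

text \<open>On the face \<open>x $ i = 0\<close>, where \<open>D1_nonneg\<close> gives no sign, the
  square-root weight vanishes.\<close>

lemma Vfun_term_nonneg:
  assumes x: "x \<in> Ssimplex"
  shows "0 \<le> D1 i x * sqrt (x $ i * (1 - x $ i) / pi)"
proof (cases "x $ i = 0")
  case False
  then show ?thesis
    using D1_nonneg[OF x, of i] bernoulli_variance_bounds(1)[OF x, of i] Ssimplex_nonneg[OF x, of i] by simp
qed simp

lemma Vfun_nonneg: "x \<in> Ssimplex \<Longrightarrow> 0 \<le> Vfun D1 x"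
  unfolding Vfun_def by (intro sum_nonneg Vfun_term_nonneg)

definition open_simplex :: "(real^'d) set" where
  "open_simplex = {x. (\<forall>i. 0 < x $ i) \<and> (\<Sum>i\<in>UNIV. x $ i) < 1}"

lemma open_open_simplex: "open open_simplex"
proof -
  have "open_simplex = (\<Inter>i. {x. 0 < x $ i}) \<inter> {x. (\<Sum>i\<in>UNIV. x $ i) < 1}"
    by (auto simp: open_simplex_def)
  moreover have "open ((\<Inter>i. {x. 0 < x $ i}) \<inter> {x :: real^'d. (\<Sum>i\<in>UNIV. x $ i) < 1})"
    by (intro open_Int open_INT ballI finite open_Collect_less continuous_intros)
  ultimately show ?thesis by simp
qed

lemma open_simplex_le: 
  assumes "x \<in> open_simplex"
  shows "x $ i < 1"
proof -
  have "x $ i \<le> (\<Sum>i\<in>UNIV. x $ i)"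
    using assms by (intro member_le_sum) (auto simp: open_simplex_def less_imp_le)
  then show ?thesis using assms by (simp add: open_simplex_def)
qed

lemma open_simplex_subset: "open_simplex \<subseteq> Ssimplex"
  using open_simplex_le
  by (auto simp: Ssimplex_def l1norm_def less_imp_le) (auto simp: open_simplex_def less_imp_le)

text \<open>The boundary is covered by finitely many hyperplanes, one per coordinate and one for the
  sum, and each of them is negligible.\<close>

lemma AE_open_simplex: "AE x in lborel. x \<in> Ssimplex \<longrightarrow> x \<in> open_simplex"
proof -
  let ?one = "(\<chi> i. 1) :: real^'d"
  have "negligible ((\<Union>i. {x::real^'d. axis i 1 \<bullet> x = 0}) \<union> {x. ?one \<bullet> x = 1})"
    by (intro negligible_Un negligible_Union negligible_hyperplane finite_imageI; force simp: axis_eq_0_iff intro!: negligible_hyperplane)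
  moreover have "Ssimplex - open_simplex \<subseteq> (\<Union>i. {x::real^'d. axis i 1 \<bullet> x = 0}) \<union> {x. ?one \<bullet> x = 1}"
  proof
    fix x :: "real^'d" assume x: "x \<in> Ssimplex - open_simplex"
    then have "(\<exists>i. x $ i \<le> 0) \<or> (\<Sum>i\<in>UNIV. x $ i) \<ge> 1" "\<And>i. x $ i \<ge> 0" "(\<Sum>i\<in>UNIV. x $ i) \<le> 1"
      using l1norm_eq_sum[of x] by (auto simp: open_simplex_def not_less Ssimplex_nonneg) (auto simp: Ssimplex_def)
    then show "x \<in> (\<Union>i. {x::real^'d. axis i 1 \<bullet> x = 0}) \<union> {x. ?one \<bullet> x = 1}"
      by (auto simp: inner_axis' inner_vec_def[of ?one] intro: antisym)
  qed
  ultimately have "negligible (Ssimplex - open_simplex)" by (rule negligible_subset)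
  then have "Ssimplex - open_simplex \<in> null_sets lborel"
    using Ssimplex_borel open_open_simplex by (simp add: negligible_iff_null_sets null_sets_completion_iff)
  then show ?thesis by (rule AE_I') auto
qed

text \<open>If the integral of \<open>V\<close> vanishes then \<open>G\<close> has zero gradient on the open simplex, so \<open>B\<close> vanishes as well.\<close>

lemma IV_pos:
  assumes IB: "IB > 0"
  shows "IV > 0"
proof (rule ccontr)
  assume neg: "\<not> IV > 0"
  have nn: "0 \<le> indicator Ssimplex x *\<^sub>R Vfun D1 x" for x
    using Vfun_nonneg[of x] by (auto simp: indicator_def)
  have "IV \<ge> 0" unfolding IV_def set_lebesgue_integral_def by (intro Bochner_Integration.integral_nonneg nn)
  with neg have "IV = 0" by simp
  then have IV0: "(LINT x|lborel. indicator Ssimplex x *\<^sub>R Vfun D1 x) = 0" unfolding IV_def set_lebesgue_integral_def .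
  have AE0: "AE x in lborel. indicator Ssimplex x *\<^sub>R Vfun D1 x = 0"
    using integral_nonneg_eq_0_iff_AE[OF set_integrable_Ssimplex[OF continuous_on_Vfun, unfolded set_integrable_def]] nn IV0
    by auto
  \<comment> \<open>\<open>Z\<close> is open by continuity and null because the integral is zero. A
    nonempty open set is not negligible, so V vanishes at every point of the open simplex.\<close>
  define Z where "Z = open_simplex \<inter> Vfun D1 -` (- {0})"
  have Z: "open Z"
    unfolding Z_def using continuous_on_subset[OF continuous_on_Vfun open_simplex_subset] open_open_simplex
    by (rule continuous_open_preimage) auto
  have "AE x in lborel. x \<notin> Z"
    using AE0 open_simplex_subset by (auto elim!: eventually_mono simp: Z_def)
  then have "Z \<in> null_sets lborel"
    using Z by (simp add: AE_iff_null_sets)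
  then have "negligible Z"
    using Z by (simp add: negligible_iff_null_sets null_sets_completion_iff)
  then have "Z = {}" using open_not_negligible[OF Z] by blast
  then have V0: "Vfun D1 x = 0" if "x \<in> open_simplex" for x using that by (auto simp: Z_def)
  have D1: "D1 i x = 0" if x: "x \<in> open_simplex" for x i
  proof -
    have "\<forall>i\<in>UNIV. D1 i x * sqrt (x $ i * (1 - x $ i) / pi) = 0"
      using V0[OF x] x open_simplex_subset unfolding Vfun_def
      by (subst (asm) sum_nonneg_eq_0_iff) (auto simp: Vfun_term_nonneg subset_iff)
    moreover have "x $ i > 0" "x $ i < 1" using x open_simplex_le[OF x] by (auto simp: open_simplex_def)
    ultimately show ?thesis by auto
  qed
  \<comment> \<open>\<open>D1 i\<close> vanishes on an open set around \<open>x\<close>, hence so do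
    its partial derivatives there.\<close>
  have D2: "D2 i j x = 0" if x: "x \<in> open_simplex" for x i j
  proof -
    have "((\<lambda>t. D1 i (x + t *\<^sub>R axis j 1)) has_real_derivative D2 i j x) (at 0)"
      using C2 U x open_simplex_subset by (auto simp: C2_partials_def has_partial_def subset_iff)
    moreover have "open ((\<lambda>t. x + t *\<^sub>R axis j 1) -` open_simplex)"
      by (intro open_vimage open_open_simplex continuous_intros)
    ultimately have "((\<lambda>t. 0) has_real_derivative D2 i j x) (at 0)"
      by (rule has_field_derivative_transform_within_open) (use x in \<open>auto simp: D1\<close>)
    then show ?thesis using DERIV_unique[OF DERIV_const] by metis
  qed
  have "AE x in lborel. indicator Ssimplex x *\<^sub>R (Bfun D2 x)\<^sup>2 = 0"
    using AE_open_simplex by eventually_elim (auto simp: indicator_def Bfun_def D2)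
  then have "IB = 0"
    unfolding IB_def set_lebesgue_integral_def by (rule integral_eq_zero_AE)
  with IB show False by simp
qed

end

section \<open>The optimal degree\<close>

text \<open>Writing \<open>n\<close> and \<open>4 * IB / IV\<close> as cubes turns the fractional
  exponents of the optimal degree into integer powers, which field arithmetic can handle.\<close>

lemma cube_powr_third:
  fixes c :: real
  assumes "c > 0"
  shows "(c ^ 3) powr (1/3) = c" "(c ^ 3) powr (2/3) = c\<^sup>2" "(c ^ 3) powr (-4/3) = 1 / c ^ 4"
proof -
  have k: "(c ^ 3) powr a = c powr (3 * a)" for a
    using assms powr_powr[of c 3 a] by (simp add: powr_numeral)
  show "(c ^ 3) powr (1/3) = c" "(c ^ 3) powr (2/3) = c\<^sup>2"
    unfolding k using assms by simp_all
  have "c powr (3 * (-4/3)) = c powr (- 4)" by simp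
  also have "\<dots> = inverse (c powr 4)" by (rule powr_minus)
  also have "\<dots> = 1 / c ^ 4" using assms by (simp add: divide_inverse)
  finally show "(c ^ 3) powr (-4/3) = 1 / c ^ 4" unfolding k .
qed

lemma cube_root_exists:
  fixes t :: real
  assumes "t > 0"
  obtains c where "c > 0" "t = c ^ 3"
  using assms by (intro that[of "root 3 t"]) auto

text \<open>The polynomial \<open>z^4 - 4 * c^3 * z\<close> has its critical point at
  \<open>z = c\<close>, so the difference of its values has the factor \<open>(z - c)^2\<close>; the
  cofactor is nonnegative for \<open>z, c >= 0\<close>.\<close>

lemma quartic_lower_bound:
  fixes z c :: real
  assumes "0 \<le> z" "0 \<le> c"
  shows "- 4 * c ^ 3 * c + c ^ 4 \<le> - 4 * c ^ 3 * z + z ^ 4"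
proof -
  have "0 \<le> (z - c)\<^sup>2 * (z\<^sup>2 + 2 * z * c + 3 * c\<^sup>2)"
    using assms by (intro mult_nonneg_nonneg add_nonneg_nonneg) auto
  also have "\<dots> = (- 4 * c ^ 3 * z + z ^ 4) - (- 4 * c ^ 3 * c + c ^ 4)"
    by algebra
  finally show ?thesis by simp
qed

context bernstein_cdf
begin

definition optimal_m :: "nat \<Rightarrow> real" where
  "optimal_m n = real n powr (2/3) * (4 * IB / IV) powr (2/3)"

lemma optimal_m_minimises:
  assumes IB: "IB > 0" and n: "n > 0" and y: "y > 0"
  shows "- 1 / (real n * sqrt (optimal_m n)) * IV + 1 / (optimal_m n)\<^sup>2 * IB
    \<le> - 1 / (real n * sqrt y) * IV + 1 / y\<^sup>2 * IB"
proof -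
  have IV: "IV > 0" using IV_pos[OF IB] .
  obtain N where N: "N > 0" "real n = N ^ 3" using cube_root_exists[of "real n"] n by auto
  obtain s where s: "s > 0" "4 * IB / IV = s ^ 3" using cube_root_exists[of "4 * IB / IV"] IB IV by auto
  have opt: "optimal_m n = (N * s)\<^sup>2"
    unfolding optimal_m_def N(2) s(2) using N(1) s(1) by (simp add: cube_powr_third power_mult_distrib)
  \<comment> \<open>In the variable \<open>z = 1 / sqrt y\<close> the leading terms read
    \<open>IB * z^4 - (IV / n) * z\<close>. The fact \<open>c3\<close> says that \<open>c\<close> is
    the critical point of this quartic.\<close>
  define c where "c = 1 / sqrt (optimal_m n)"
  have c_eq: "c = 1 / (N * s)" using N s by (simp add: c_def opt)
  have "4 * IB = IV * s ^ 3" using s(2) IV by (simp add: field_simps)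
  then have "IB * (4 * c ^ 3) = IV * (s ^ 3 * c ^ 3)" by simp
  also have "s ^ 3 * c ^ 3 = 1 / N ^ 3" using s N by (simp add: c_eq power_divide power_mult_distrib)
  finally have c3: "IV / n = IB * (4 * c ^ 3)" by (simp add: N(2))
  have c: "c \<ge> 0" using N s by (simp add: c_eq)
  have eq: "- 1 / (real n * sqrt t) * IV + 1 / t\<^sup>2 * IB = IB * (- 4 * c ^ 3 * (1 / sqrt t) + (1 / sqrt t) ^ 4)" if "t > 0" for t
  proof -
    have "(1 / sqrt t) ^ 4 = 1 / t\<^sup>2"
      using that by (simp add: power_divide power4_eq_xxxx power2_eq_square)
    moreover have "- 1 / (real n * sqrt t) * IV = - (IV / n) * (1 / sqrt t)" by simp
    ultimately show ?thesis unfolding c3 by (simp add: algebra_simps)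
  qed
  have "optimal_m n > 0" using N s by (simp add: opt)
  from eq[OF this] have "- 1 / (real n * sqrt (optimal_m n)) * IV + 1 / (optimal_m n)\<^sup>2 * IB = IB * (- 4 * c ^ 3 * c + c ^ 4)"
    unfolding c_def .
  also have "\<dots> \<le> IB * (- 4 * c ^ 3 * (1 / sqrt y) + (1 / sqrt y) ^ 4)"
    using IB y c by (intro mult_left_mono quartic_lower_bound) auto
  finally show ?thesis unfolding eq[OF y] .
qed

lemma optimal_value:
  assumes IB: "IB > 0"
  defines "\<kappa> \<equiv> (4 * IB / IV) powr (2/3)"
  shows "- IV / sqrt \<kappa> + IB / \<kappa>\<^sup>2 = - ((3/4) * (IV ^ 4 / (4 * IB)) powr (1/3))"
proof -
  have IV: "IV > 0" using IV_pos[OF IB] .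
  obtain s where s: "s > 0" "4 * IB / IV = s ^ 3" using cube_root_exists[of "4 * IB / IV"] IB IV by auto
  have \<kappa>: "\<kappa> = s\<^sup>2" unfolding \<kappa>_def s(2) using s(1) by (rule cube_powr_third)
  \<comment> \<open>Both leading terms are multiples of \<open>T\<close>, namely \<open>- T\<close>
    and \<open>T / 4\<close>; this is the origin of the factor 3/4.\<close>
  define T where "T = 4 * IB / s ^ 4"
  have T: "T > 0" using IB s by (simp add: T_def)
  have IV_eq: "IV = 4 * IB / s ^ 3" using s(2)[symmetric] IV IB s(1) by (simp add: field_simps)
  have "IV ^ 4 / (4 * IB) = T ^ 3"
    unfolding IV_eq T_def using IB s(1) by (simp add: power_divide power_mult_distrib field_simps flip: power_mult)
      (simp add: eval_nat_numeral)
  then have "(IV ^ 4 / (4 * IB)) powr (1/3) = T"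
    using cube_powr_third(1)[OF T] by simp
  moreover have "- IV / sqrt \<kappa> = - T"
    unfolding \<kappa> IV_eq T_def using s(1) by (simp add: eval_nat_numeral)
  moreover have "IB / \<kappa>\<^sup>2 = T / 4"
    unfolding \<kappa> T_def using s(1) by (simp flip: power_mult)
  ultimately show ?thesis by (simp only:)
qed

theorem MISE_at_optimal_m:
  assumes IB: "IB > 0" and m: "(\<lambda>n. real (m n) / optimal_m n) \<longlonglongrightarrow> 1"
  shows "\<exists>r. r \<in> o(\<lambda>n. real n powr (-4/3)) \<and>
    (\<forall>n. MISE M X F n (m n) = 1 / real n * IS - real n powr (-4/3) * (3/4) * (IV ^ 4 / (4 * IB)) powr (1/3) + r n)"
proof (intro exI conjI)
  have IV: "IV > 0" using IV_pos[OF IB] .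
  define \<kappa> where "\<kappa> = (4 * IB / IV) powr (2/3)"
  have \<kappa>: "\<kappa> > 0" using IB IV by (simp add: \<kappa>_def)
  define L where "L = (3/4) * (IV ^ 4 / (4 * IB)) powr (1/3)"
  define u where "u n = real (m n) / optimal_m n" for n
  have u: "u \<longlonglongrightarrow> 1" using m by (simp add: u_def[abs_def])
  define r where "r n = MISE M X F n (m n) - (1 / real n * IS - real n powr (-4/3) * L)" for n
  have opt_top: "filterlim optimal_m at_top sequentially"
  proof -
    have "filterlim (\<lambda>n. real n powr (2/3) * \<kappa>) at_top sequentially"
      using \<kappa> by real_asymp
    then show ?thesis by (simp add: optimal_m_def[abs_def] \<kappa>_def)
  qed
  have m_eq: "real (m n) = u n * (real n powr (2/3) * \<kappa>)" if "n > 0" for n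
    using that \<kappa> by (simp add: u_def optimal_m_def \<kappa>_def)
  have "filterlim (\<lambda>n. u n * optimal_m n) at_top sequentially"
    by (rule filterlim_tendsto_pos_mult_at_top[OF u _ opt_top]) simp
  then have "filterlim (\<lambda>n. real (m n)) at_top sequentially"
  proof (rule filterlim_mono_eventually)
    show "\<forall>\<^sub>F n in sequentially. u n * optimal_m n = real (m n)"
      using eventually_gt_at_top[of 0]
      by eventually_elim (simp add: m_eq optimal_m_def \<kappa>_def)
  qed auto
  then have m_top: "filterlim m at_top sequentially"
    by (simp add: filterlim_sequentially_iff_filterlim_real)
  \<comment> \<open>The remainder multiplied by \<open>n powr (4/3)\<close>. Its limit is zero
    because \<open>optimal_value\<close> makes the two leading terms cancel against
    \<open>L\<close>.\<close>
  define b where "b n = var_remainder (m n) / (sqrt (u n) * sqrt \<kappa>) + scaled_bias (m n) / ((u n)\<^sup>2 * \<kappa>\<^sup>2) + L" for n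
  have "b \<longlonglongrightarrow> - IV / (sqrt 1 * sqrt \<kappa>) + IB / (1\<^sup>2 * \<kappa>\<^sup>2) + L"
    unfolding b_def[abs_def] using \<kappa>
    by (intro tendsto_intros u filterlim_compose[OF var_remainder_limit m_top] filterlim_compose[OF scaled_bias_limit m_top]) auto
  then have b: "b \<longlonglongrightarrow> 0"
    using optimal_value[OF IB] by (simp add: L_def \<kappa>_def)
  have pos: "\<forall>\<^sub>F n in sequentially. n > 0 \<and> m n > 0"
    using eventually_gt_at_top[of 0] filterlim_at_top[THEN iffD1, OF m_top, rule_format, of 1]
    by eventually_elim simp
  show "r \<in> o(\<lambda>n. real n powr (-4/3))"
  proof (rule smalloI_tendsto)
    show "(\<lambda>n. r n / real n powr (-4/3)) \<longlonglongrightarrow> 0"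
    proof (rule Lim_transform_eventually[OF b])
      show "\<forall>\<^sub>F n in sequentially. b n = r n / real n powr (-4/3)"
        using pos
      proof eventually_elim
        case (elim n)
        obtain N where N: "N > 0" "real n = N ^ 3" using cube_root_exists[of "real n"] elim by auto
        have powers: "real n powr (2/3) = N\<^sup>2" "real n powr (-4/3) = 1 / N ^ 4"
          unfolding N(2) by (rule cube_powr_third[OF N(1)])+
        have "u n > 0"
          using elim IB IV by (simp add: u_def optimal_m_def)
        have "sqrt (real (m n)) = sqrt (u n) * sqrt \<kappa> * N"
          using elim N(1) by (simp add: m_eq powers real_sqrt_mult)
        then have s: "real n * sqrt (real (m n)) = N ^ 4 * (sqrt (u n) * sqrt \<kappa>)"
          by (simp add: N(2) eval_nat_numeral)
        have m2: "(real (m n))\<^sup>2 = N ^ 4 * ((u n)\<^sup>2 * \<kappa>\<^sup>2)"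
          using elim by (simp add: m_eq powers(1) power_mult_distrib flip: power_mult)
        have "MISE M X F n (m n) = IS / n + var_remainder (m n) / (real n * sqrt (real (m n))) + scaled_bias (m n) / (real (m n))\<^sup>2"
          using elim by (intro MISE_decomposition) auto
        then have "r n = (1 / N ^ 4) * b n"
          unfolding r_def b_def s m2 powers(2) by (simp add: distrib_left)
        then show ?case unfolding powers(2) using N(1) by simp
      qed
    qed
    show "\<forall>\<^sub>F n in sequentially. real n powr (-4/3) \<noteq> 0" using pos by eventually_elim simp
  qed
  show "\<forall>n. MISE M X F n (m n) = 1 / real n * IS - real n powr (-4/3) * (3/4) * (IV ^ 4 / (4 * IB)) powr (1/3) + r n"
    by (simp add: r_def L_def)
qed

end

text \<open>A degree is an integer while \<open>mopt n\<close> is real, so optimality has two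
  halves: exact minimisation of the leading terms over real \<open>y\<close>, and the expansion
  along every integer sequence asymptotic to \<open>mopt\<close>.\<close>

theorem theorem2:
  fixes M :: "'a measure" and X :: "nat \<Rightarrow> 'a \<Rightarrow> real^'d"
    and \<mu> :: "(real^'d) measure" and F :: "real^'d \<Rightarrow> real"
    and U :: "(real^'d) set" and G :: "real^'d \<Rightarrow> real"
    and D1 :: "'d \<Rightarrow> real^'d \<Rightarrow> real" and D2 :: "'d \<Rightarrow> 'd \<Rightarrow> real^'d \<Rightarrow> real"
    and m :: "nat \<Rightarrow> nat"
  assumes M: "prob_space M"
    and mu: "prob_space \<mu>" "sets \<mu> = sets borel" "measure \<mu> Ssimplex = 1"
    and F_cdf: "\<And>x. F x = measure \<mu> {y. \<forall>j. y $ j \<le> x $ j}"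
    and X_meas: "\<And>i. X i \<in> borel_measurable M"
    and X_dist: "\<And>i. distr M borel (X i) = \<mu>"
    and X_indep: "prob_space.indep_vars M (\<lambda>_. borel) X UNIV"
    and U: "open U" "Ssimplex \<subseteq> U"
    and G: "\<And>x. x \<in> Ssimplex \<Longrightarrow> G x = F x"
    and C2: "C2_partials U G D1 D2"
    and m_lim: "filterlim m at_top sequentially"
  shows
   "(\<exists>r1 r2. r1 \<in> o(\<lambda>n. 1 / (real n * sqrt (real (m n)))) \<and>
             r2 \<in> o(\<lambda>n. 1 / (real (m n))^2) \<and>
             (\<forall>n. MISE M X F n (m n) =
                    1 / real n * (LINT x:Ssimplex|lborel. sigma2 F x)
                  - 1 / (real n * sqrt (real (m n))) * (LINT x:Ssimplex|lborel. Vfun D1 x)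
                  + 1 / (real (m n))^2 * (LINT x:Ssimplex|lborel. (Bfun D2 x)^2)
                  + r1 n + r2 n))
    \<and>
    ((LINT x:Ssimplex|lborel. (Bfun D2 x)^2) > 0 \<longrightarrow>
      (let IS = (LINT x:Ssimplex|lborel. sigma2 F x);
           IV = (LINT x:Ssimplex|lborel. Vfun D1 x);
           IB = (LINT x:Ssimplex|lborel. (Bfun D2 x)^2);
           mopt = (\<lambda>n::nat. real n powr (2/3) * (4 * IB / IV) powr (2/3));
           amise = (\<lambda>(n::nat) (y::real). - 1 / (real n * sqrt y) * IV + 1 / y^2 * IB)
       in (\<forall>n::nat. n > 0 \<longrightarrow> mopt n > 0 \<and> (\<forall>y>0. amise n (mopt n) \<le> amise n y)) \<and>
          (\<forall>m' :: nat \<Rightarrow> nat. ((\<lambda>n. real (m' n) / mopt n) \<longlonglongrightarrow> 1) \<longrightarrow>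
             (\<exists>r. r \<in> o(\<lambda>n. real n powr (-4/3)) \<and>
                  (\<forall>n. MISE M X F n (m' n) =
                         1 / real n * IS
                       - real n powr (-4/3) * (3/4) * (IV^4 / (4 * IB)) powr (1/3)
                       + r n)))))"
proof -
  interpret bernstein_cdf U G D1 D2 M \<mu> X F
    using assms by (intro bernstein_cdf.intro smooth_on_simplex.intro bernstein_cdf_axioms.intro) auto
  show ?thesis
    unfolding Let_def IS_def[symmetric] IV_def[symmetric] IB_def[symmetric] optimal_m_def[symmetric]
  proof (intro conjI impI allI)
    show "\<exists>r1 r2. r1 \<in> o(\<lambda>n. 1 / (real n * sqrt (real (m n)))) \<and> r2 \<in> o(\<lambda>n. 1 / (real (m n))\<^sup>2) \<and>
      (\<forall>n. MISE M X F n (m n) = 1 / real n * IS - 1 / (real n * sqrt (real (m n))) * IV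
         + 1 / (real (m n))\<^sup>2 * IB + r1 n + r2 n)"
      by (rule MISE_expansion[OF m_lim])
  next
    fix n :: nat assume "IB > 0" "n > 0"
    then show "optimal_m n > 0" using IV_pos by (simp add: optimal_m_def)
  next
    fix n :: nat and y :: real assume "IB > 0" "n > 0" "y > 0"
    then show "- 1 / (real n * sqrt (optimal_m n)) * IV + 1 / (optimal_m n)\<^sup>2 * IB
      \<le> - 1 / (real n * sqrt y) * IV + 1 / y\<^sup>2 * IB"
      by (rule optimal_m_minimises)
  next
    fix m' :: "nat \<Rightarrow> nat" assume "IB > 0" "(\<lambda>n. real (m' n) / optimal_m n) \<longlonglongrightarrow> 1"
    then show "\<exists>r. r \<in> o(\<lambda>n. real n powr (-4/3)) \<and>
      (\<forall>n. MISE M X F n (m' n) = 1 / real n * IS - real n powr (-4/3) * (3/4) * (IV ^ 4 / (4 * IB)) powr (1/3) + r n)"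
      by (rule MISE_at_optimal_m)
  qed
qed

end
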